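(* Let $K\subset\mathbf V^*$ be a nonempty convex compact set, let $f:\mathbf V^*\to\mathbb R$ be convex and $L$-smooth with respect to $\|\cdot\|_*$, let $x_0\in K$, and let $x_\star\in\arg\min_{x\in K}f(x)$. Let $(x_k)$ and $(y_k)$ be generated by the Parallel Frank-Wolfe algorithm described in the context, with smoothing parameter $\alpha>0$ and $m\ge1$ parallel computing units, and suppose $\frac{R_KM}{\alpha}\ge\frac1L$. Suppose $\rho_{\|\cdot\|_*}$ is a constant depending only on the norm such that for every $k$ $$\mathbb E_k\Big\|\frac1m\sum_{i=1}^m g_{k,i}-\nabla G(v_k)\Big\|_*^2\le\frac{4R_K^2\rho_{\|\cdot\|_*}}{m},\qquad\text{where } G(y)=s_\alpha(-y).$$ Then the primal iterates are always feasible, i.e. $x_k\in K$ for all $k\in\mathbb N$. Moreover, after $k\ge1$ iterations, $$\mathbb E[f(x_k)-d(y_k)]\le\exp\left(-(k-1)\frac{\sqrt\alpha}{8\sqrt{LR_KM}}\right)2L\,\frac{R_KM}{\alpha}\,(f(x_0)-f(x_\star))+\frac{2R_K^2\rho_{\|\cdot\|_*}}{m}\sqrt{\frac{\alpha L}{R_KM}}+\alpha s_1(0).$$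
   Context: $\mathbf V$ is a real finite-dimensional vector space with norm $\|\cdot\|$, $\mathbf V^*$ its dual space, $\langle\cdot,\cdot\rangle:\mathbf V^*\times\mathbf V\to\mathbb R$ the dual pairing, and $\|z\|_*=\sup_{\|x\|\le1}\langle z,x\rangle$ the dual norm. $f$ is $L$-smooth w.r.t. $\|\cdot\|_*$ ($L>0$) if it is differentiable, with $\nabla f(x)\in\mathbf V$ and $\|\nabla f(x)-\nabla f(x')\|\le L\|x-x'\|_*$ for all $x,x'\in\mathbf V^*$. $f^*(y)=\sup_{x\in\mathbf V^*}\langle x,y\rangle-f(x)$ is the convex conjugate. $s(y)=\sup_{x\in K}\langle x,y\rangle$ is the support function of $K$. The dual objective of $\min_{x\in K}f(x)$ is $d(y)=-s(-y)-f^*(y)$, $y\in\mathbf V$. $R_K=\max_{x\in K}\|x\|_*$. $\Delta$ is a random variable in $\mathbf V$ with positive differentiable density $d\pi(z)\propto\exp(-\eta(z))\,dz$, and $M^2=\mathbb E\|\nabla\eta(\Delta)\|_*^2$; $R_K>0$ and $0<M<\infty$. For $\alpha>0$ the smoothed support function is $s_\alpha(y)=\mathbb E_\Delta[s(y+\alpha\Delta)]=\mathbb E_\Delta[\sup_{x\in K}\langle x,y+\alpha\Delta\rangle]$; in particular $s_1(0)=\mathbb E_\Delta[\sup_{x\in K}\langle x,\Delta\rangle]$. Standing properties of $s_\alpha$: it is convex, $\frac{R_KM}{\alpha}$-smooth w.r.t. $\|\cdot\|$ (i.e. $\|\nabla s_\alpha(y)-\nabla s_\alpha(y')\|_*\le\frac{R_KM}{\alpha}\|y-y'\|$),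 and for all $y\in\mathbf V$, $\nabla s_\alpha(y)=\mathbb E_\Delta[\arg\max_{x\in K}\langle x,y+\alpha\Delta\rangle]$ and $s(y)\le s_\alpha(y)\le s(y)+\alpha s_1(0)$. Parallel Frank-Wolfe algorithm. Set $A_0=0$, $d_0=0\in\mathbf V^*$, $\beta=\frac{R_KM}{\alpha}$, $\mu=\frac1L$, $y_0=\nabla f(x_0)$. For $k=0,1,2,\dots$: $$A_{k+1}=\frac{A_k(\mu+2\beta+\sqrt{\mu\beta})+\beta\mu+\sqrt{\mu^2(\beta+A_k)^2+4A_k\beta^2\mu+5A_k^2\mu\beta+2A_k\mu\sqrt{\mu\beta}\,(\beta+A_k)}}{2(\beta+\sqrt{\mu\beta})},$$ $\tau_k=1-\frac{A_k}{A_{k+1}}$; $v_k=(1-\tau_k)y_k+\tau_k\nabla f(x_k)$; for $i=1,\dots,m$ sample independently (of each other and of the past) $\Delta_i\sim d\pi$ and compute $g_{k,i}=-\arg\max_{u\in K}\langle u,-v_k+\alpha\Delta_i\rangle$; $g_k=\frac1m\sum_{i=1}^m g_{k,i}$; $d_{k+1}=d_k+(A_{k+1}-A_k)g_k$; $x_{k+1}=\frac{\beta}{A_{k+1}+\beta}x_0-\frac{1}{A_{k+1}+\beta}d_{k+1}$; $y_{k+1}=(1-\tau_k)y_k+\tau_k\nabla f(x_{k+1})$. (The vectors $d_k\in\mathbf V^*$ of the algorithm are unrelated to the dual function $d(\cdot)$.) $\mathbb E_k$ is expectation at iteration $k$ conditioned on the previous iterations; $\mathbb E$ is total expectation. *)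

theory Defs
  imports "HOL-Probability.Probability"
begin

text \<open>
  A real finite-dimensional space \<open>V\<close> with an arbitrary norm is modelled by a type \<open>'v\<close> of class
  \<open>euclidean_space\<close> together with a function \<open>N :: 'v \<Rightarrow> real\<close> satisfying the norm axioms; the type
  class norm is never used as the norm of \<open>V\<close>.  The inner product only plays the role of the
  dual pairing: it represents every linear functional on \<open>V\<close> by exactly one vector of \<open>'v\<close>, so
  elements of \<open>V\<^sup>*\<close> are vectors of \<open>'v\<close> as well, carrying the norm \<open>dual_norm N\<close>.  \<open>lborel\<close> serves
  as the reference measure \<open>dz\<close> on \<open>V\<close>.
\<close>

definition is_norm :: "('v::real_vector \<Rightarrow> real) \<Rightarrow> bool" where
  "is_norm N \<longleftrightarrow>
     (\<forall>x. N x = 0 \<longleftrightarrow> x = 0) \<and>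
     (\<forall>x y. N (x + y) \<le> N x + N y) \<and>
     (\<forall>c x. N (c *\<^sub>R x) = \<bar>c\<bar> * N x)"

definition dual_norm :: "('v::euclidean_space \<Rightarrow> real) \<Rightarrow> 'v \<Rightarrow> real" where
  "dual_norm N z = (SUP x\<in>{x. N x \<le> 1}. inner z x)"

text \<open>Unspecified where the function is not differentiable.\<close>

definition grad :: "('v::euclidean_space \<Rightarrow> real) \<Rightarrow> 'v \<Rightarrow> 'v" where
  "grad h x = (THE g. GDERIV h x :> g)"

text \<open>
  \<open>L\<close>-smoothness with respect to the dual norm of a function on the dual space, so that gradients
  live in \<open>V\<close> and are measured by \<open>N\<close>.
\<close>

definition smooth_dual :: "('v::euclidean_space \<Rightarrow> real) \<Rightarrow> real \<Rightarrow> ('v \<Rightarrow> real) \<Rightarrow> bool" where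
  "smooth_dual N L f \<longleftrightarrow>
     (\<forall>x. f differentiable (at x)) \<and>
     (\<forall>x x'. N (grad f x - grad f x') \<le> L * dual_norm N (x - x'))"

definition conjugate :: "('v::euclidean_space \<Rightarrow> real) \<Rightarrow> 'v \<Rightarrow> ereal" where
  "conjugate f y = (SUP x. ereal (inner x y - f x))"

text \<open>Only meaningful for nonempty bounded \<open>K\<close>.\<close>

definition support_fun :: "'v::euclidean_space set \<Rightarrow> 'v \<Rightarrow> real" where
  "support_fun K y = (SUP x\<in>K. inner x y)"

definition dual_objective :: "'v::euclidean_space set \<Rightarrow> ('v \<Rightarrow> real) \<Rightarrow> 'v \<Rightarrow> ereal" where
  "dual_objective K f y = - ereal (support_fun K (- y)) - conjugate f y"

text \<open>The density proportional to \<open>exp (- \<eta> z)\<close>, and the corresponding law.\<close>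

definition noise_density :: "('v::euclidean_space \<Rightarrow> real) \<Rightarrow> 'v \<Rightarrow> real" where
  "noise_density \<eta> z = exp (- \<eta> z) / (\<integral>u. exp (- \<eta> u) \<partial>lborel)"

definition noise_law :: "('v::euclidean_space \<Rightarrow> real) \<Rightarrow> 'v measure" where
  "noise_law \<eta> = density lborel (\<lambda>z. ennreal (noise_density \<eta> z))"

definition smoothed_support ::
    "'v::euclidean_space set \<Rightarrow> ('v \<Rightarrow> real) \<Rightarrow> real \<Rightarrow> 'v \<Rightarrow> real" where
  "smoothed_support K \<eta> \<alpha> y = (\<integral>z. support_fun K (y + \<alpha> *\<^sub>R z) \<partial>noise_law \<eta>)"

primrec A_seq :: "real \<Rightarrow> real \<Rightarrow> nat \<Rightarrow> real" where
  "A_seq \<beta> \<mu> 0 = 0"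
| "A_seq \<beta> \<mu> (Suc k) =
     (let A = A_seq \<beta> \<mu> k in
       (A * (\<mu> + 2 * \<beta> + sqrt (\<mu> * \<beta>)) + \<beta> * \<mu>
         + sqrt (\<mu>\<^sup>2 * (\<beta> + A)\<^sup>2 + 4 * A * \<beta>\<^sup>2 * \<mu> + 5 * A\<^sup>2 * \<mu> * \<beta>
                 + 2 * A * \<mu> * sqrt (\<mu> * \<beta>) * (\<beta> + A)))
       / (2 * (\<beta> + sqrt (\<mu> * \<beta>))))"

definition tau_seq :: "real \<Rightarrow> real \<Rightarrow> nat \<Rightarrow> real" where
  "tau_seq \<beta> \<mu> k = 1 - A_seq \<beta> \<mu> k / A_seq \<beta> \<mu> (Suc k)"

text \<open>
  Linear maximization over \<open>K\<close>: a Borel measurable selection \<open>w \<mapsto> argmax\<^bsub>u \<in> K\<^esub> \<langle>u, w\<rangle>\<close>.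
  The tie-breaking rule is arbitrary.
\<close>

definition lin_max_selection :: "'v::euclidean_space set \<Rightarrow> ('v \<Rightarrow> 'v) \<Rightarrow> bool" where
  "lin_max_selection K lmo \<longleftrightarrow>
     lmo \<in> borel_measurable borel \<and>
     (\<forall>w. is_arg_max (\<lambda>u. inner u w) (\<lambda>u. u \<in> K) (lmo w))"

text \<open>
  One run of the algorithm for the fixed realization \<open>\<delta> k i\<close> of the sampled perturbations
  (\<open>i < m\<close> at iteration \<open>k\<close>).
\<close>

definition parallel_frank_wolfe ::
    "('v::euclidean_space \<Rightarrow> real) \<Rightarrow> ('v \<Rightarrow> 'v) \<Rightarrow> real \<Rightarrow> real \<Rightarrow> real \<Rightarrow> nat \<Rightarrow> 'v
      \<Rightarrow> (nat \<Rightarrow> nat \<Rightarrow> 'v)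
      \<Rightarrow> (nat \<Rightarrow> 'v) \<Rightarrow> (nat \<Rightarrow> 'v) \<Rightarrow> (nat \<Rightarrow> 'v) \<Rightarrow> (nat \<Rightarrow> 'v) \<Rightarrow> (nat \<Rightarrow> nat \<Rightarrow> 'v) \<Rightarrow> bool" where
  "parallel_frank_wolfe f lmo \<alpha> \<beta> \<mu> m x0 \<delta> x y d v g \<longleftrightarrow>
     d 0 = 0 \<and> x 0 = x0 \<and> y 0 = grad f x0 \<and>
     (\<forall>k. let A = A_seq \<beta> \<mu> k; A' = A_seq \<beta> \<mu> (Suc k); \<tau> = tau_seq \<beta> \<mu> k in
        v k = (1 - \<tau>) *\<^sub>R y k + \<tau> *\<^sub>R grad f (x k) \<and>
        (\<forall>i<m. g k i = - lmo (- v k + \<alpha> *\<^sub>R \<delta> k i)) \<and>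
        d (Suc k) = d k + (A' - A) *\<^sub>R ((1 / real m) *\<^sub>R (\<Sum>i<m. g k i)) \<and>
        x (Suc k) = (\<beta> / (A' + \<beta>)) *\<^sub>R x0 - (1 / (A' + \<beta>)) *\<^sub>R d (Suc k) \<and>
        y (Suc k) = (1 - \<tau>) *\<^sub>R y k + \<tau> *\<^sub>R grad f (x (Suc k)))"

text \<open>The \<open>\<sigma>\<close>-algebra generated by all perturbations sampled before iteration \<open>k\<close>.\<close>

definition past_algebra :: "'b measure \<Rightarrow> (nat \<Rightarrow> nat \<Rightarrow> 'b \<Rightarrow> 'v::euclidean_space) \<Rightarrow> nat \<Rightarrow> nat \<Rightarrow> 'b measure"
  where
  "past_algebra P \<Delta> m k =
     vimage_algebra (space P) (\<lambda>\<omega>. \<lambda>(j, i)\<in>{..<k} \<times> {..<m}. \<Delta> j i \<omega>)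
       (PiM ({..<k} \<times> {..<m}) (\<lambda>_. borel))"

end

theory Submission
  imports Defs
begin

text \<open>
  The algorithm is an accelerated dual averaging method for the smoothed dual problem: minimize
  \<open>G + f\<^sup>*\<close> over \<open>V\<close>, where \<open>G y = s\<^sub>\<alpha> (- y)\<close> is the smoothed support function.  Write
  \<open>\<beta> = R M / \<alpha>\<close>, \<open>\<mu> = 1 / L\<close>, \<open>s = sqrt (\<mu> \<beta>)\<close> and \<open>w\<^sub>k = \<nabla>f x\<^sub>k\<close>.  Two regularity facts drive the
  analysis: \<open>f\<^sup>*\<close> is \<open>\<mu>\<close>-strongly convex, which is used in its primal form as co-coercivity of \<open>\<nabla>f\<close>
  (\<open>smooth_convex_cocoercive\<close>), and \<open>G\<close> is convex and \<open>\<beta>\<close>-smooth (\<open>dual_smoothing_upper_bound\<close>).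
  The latter holds because \<open>\<nabla>s\<^sub>\<alpha>\<close> is the mean of a bounded function of the perturbed argument, so that
  moving the argument amounts to translating the noise density, and a translation by \<open>h\<close> changes that
  density in \<open>L\<^sup>1\<close> by at most \<open>N h M\<close> (\<open>noise_density_translation\<close>).

  Let \<open>\<xi>\<^sub>k\<close> be the difference between the averaged samples and \<open>\<nabla>G v\<^sub>k\<close>.  The potential
  \<open>A\<^sub>k (G y\<^sub>k + f\<^sup>* y\<^sub>k) + (A\<^sub>k + \<beta>) f x\<^sub>k\<close> starts at \<open>\<beta> f x\<^sub>0\<close> and grows in step \<open>k\<close> by at most
  \<open>A\<^sub>k\<^sub>+\<^sub>1 - A\<^sub>k\<close> times \<open>G v\<^sub>k - \<langle>\<nabla>G v\<^sub>k, v\<^sub>k\<rangle> - \<langle>\<xi>\<^sub>k, w\<^sub>k\<rangle> + dual_norm N \<xi>\<^sub>k\<^sup>2 / (2 s)\<close>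
  (\<open>potential_step\<close>); the recursion for \<open>A\<^sub>k\<close> is exactly the condition under which all terms
  quadratic in \<open>w\<^sub>k\<^sub>+\<^sub>1 - w\<^sub>k\<close> cancel (\<open>A_seq_Suc_root\<close>).  The first two summands are at most
  \<open>\<alpha> s\<^sub>1 0\<close> (\<open>dual_smoothing_tangent_at_0\<close>).  The third has mean zero because \<open>w\<^sub>k\<close> is determined by the
  past while the samples of step \<open>k\<close> are independent of it and unbiased (\<open>noise_error_unbiased\<close>), and the
  mean of the fourth is controlled by the variance hypothesis.  Since the original support function lies
  below its smoothing, the potential dominates \<open>A\<^sub>k\<close> times the duality gap plus \<open>\<beta> f x\<^sub>k\<close>, and dividing
  by \<open>A\<^sub>k\<close>, which grows geometrically from \<open>\<mu> / 2\<close> (\<open>A_seq_growth\<close>), gives the bound.  Feasibility is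
  seen directly: \<open>x\<^sub>k\<^sub>+\<^sub>1\<close> is a convex combination of \<open>x\<^sub>k\<close> and points returned by the linear maximization.
\<close>

section \<open>Norms and dual norms\<close>

lemma is_normD:
  assumes "is_norm N"
  shows "N x = 0 \<longleftrightarrow> x = 0" "N (x + y) \<le> N x + N y" "N (c *\<^sub>R x) = \<bar>c\<bar> * N x"
  using assms unfolding is_norm_def by blast+

lemma is_norm_zero: "is_norm N \<Longrightarrow> N 0 = 0"
  using is_normD(1) by blast

lemma is_norm_minus: "is_norm N \<Longrightarrow> N (- x) = N x"
  using is_normD(3)[of N "-1" x] by simp

lemma is_norm_commute: "is_norm N \<Longrightarrow> N (x - y) = N (y - x)"
  using is_norm_minus[of N "x - y"] by simp

lemma is_norm_nonneg:
  assumes "is_norm N" shows "0 \<le> N x"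
  using is_normD(2)[OF assms, of x "- x"] is_norm_minus[OF assms, of x] is_norm_zero[OF assms]
  by simp

lemma is_norm_pos: "is_norm N \<Longrightarrow> x \<noteq> 0 \<Longrightarrow> 0 < N x"
  using is_normD(1) is_norm_nonneg by (metis less_eq_real_def)

lemma is_norm_sum:
  assumes "is_norm N" shows "N (\<Sum>i\<in>I. f i) \<le> (\<Sum>i\<in>I. N (f i))"
proof (induction I rule: infinite_finite_induct)
  case (insert a I)
  then show ?case using is_normD(2)[OF assms, of "f a" "sum f I"] by simp
qed (simp_all add: is_norm_zero[OF assms])

lemma is_norm_convex_less:
  assumes "is_norm N" shows "convex {x. N x < 1}"
proof (rule convexI)
  fix x y and u v :: real
  assume *: "x \<in> {x. N x < 1}" "y \<in> {x. N x < 1}" "0 \<le> u" "0 \<le> v" "u + v = 1"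
  have "N (u *\<^sub>R x + v *\<^sub>R y) \<le> u * N x + v * N y"
    using is_normD(2)[OF assms, of "u *\<^sub>R x" "v *\<^sub>R y"] is_normD(3)[OF assms] * by simp
  also have "\<dots> < 1"
    using convex_bound_lt[of "N x" 1 "N y" u v] * by simp
  finally show "u *\<^sub>R x + v *\<^sub>R y \<in> {x. N x < 1}" by simp
qed

lemma is_norm_le_norm:
  fixes N :: "'v::euclidean_space \<Rightarrow> real"
  assumes "is_norm N"
  obtains C where "0 < C" "\<And>x. N x \<le> C * norm x"
proof
  let ?C = "(\<Sum>b\<in>Basis. N b) + 1"
  show "0 < ?C" using sum_nonneg[of Basis N] is_norm_nonneg[OF assms] by (simp add: add_nonneg_pos)
  fix x :: 'v
  have "N x = N (\<Sum>b\<in>Basis. (x \<bullet> b) *\<^sub>R b)" by (simp add: euclidean_representation)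
  also have "\<dots> \<le> (\<Sum>b\<in>Basis. \<bar>x \<bullet> b\<bar> * N b)"
    using is_norm_sum[OF assms, of "\<lambda>b. (x \<bullet> b) *\<^sub>R b" Basis] by (simp add: is_normD(3)[OF assms])
  also have "\<dots> \<le> (\<Sum>b\<in>Basis. norm x * N b)"
    by (intro sum_mono mult_right_mono Basis_le_norm is_norm_nonneg[OF assms])
  also have "\<dots> \<le> ?C * norm x" by (simp add: sum_distrib_left algebra_simps)
  finally show "N x \<le> ?C * norm x" .
qed

lemma is_norm_abs_diff:
  assumes "is_norm N" shows "\<bar>N x - N y\<bar> \<le> N (x - y)"
  using is_normD(2)[OF assms, of "x - y" y] is_normD(2)[OF assms, of "y - x" x]
    is_norm_commute[OF assms, of x y] by simp

lemma is_norm_continuous: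
  fixes N :: "'v::euclidean_space \<Rightarrow> real"
  assumes "is_norm N" shows "continuous_on S N"
proof -
  obtain C where C: "0 < C" "\<And>x. N x \<le> C * norm x" using is_norm_le_norm[OF assms] by blast
  have "C-lipschitz_on S N"
    using C is_norm_abs_diff[OF assms] by (intro lipschitz_onI)
      (auto simp: dist_real_def dist_norm intro: order_trans)
  then show ?thesis by (rule lipschitz_on_continuous_on)
qed

lemma is_norm_measurable [measurable]:
  fixes N :: "'v::euclidean_space \<Rightarrow> real"
  assumes "is_norm N" shows "N \<in> borel_measurable borel"
  by (intro borel_measurable_continuous_onI is_norm_continuous assms)

lemma norm_le_is_norm:
  fixes N :: "'v::euclidean_space \<Rightarrow> real"
  assumes "is_norm N"
  obtains C where "0 < C" "\<And>x. norm x \<le> C * N x"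
proof -
  have "compact (sphere (0::'v) 1)" "sphere (0::'v) 1 \<noteq> {}" by auto
  then obtain z where z: "z \<in> sphere 0 1" "\<And>u. u \<in> sphere 0 1 \<Longrightarrow> N z \<le> N u"
    using continuous_attains_inf[of "sphere (0::'v) 1" N] is_norm_continuous[OF assms] by metis
  have pos: "0 < N z" using z(1) by (intro is_norm_pos[OF assms]) auto
  have "norm x \<le> (1 / N z) * N x" for x
  proof (cases "x = 0")
    case False
    then have "N z \<le> N ((1 / norm x) *\<^sub>R x)" by (intro z(2)) simp
    also have "\<dots> = N x / norm x" by (simp add: is_normD(3)[OF assms])
    finally show ?thesis using False pos by (simp add: field_simps)
  qed (simp add: is_norm_zero[OF assms])
  then show ?thesis using that[of "1 / N z"] pos by simp
qed

lemma dual_norm_bdd_above: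
  fixes N :: "'v::euclidean_space \<Rightarrow> real"
  assumes "is_norm N" shows "bdd_above ((\<lambda>x. inner z x) ` {x. N x \<le> 1})"
proof -
  obtain C where C: "0 < C" "\<And>x. norm x \<le> C * N x" using norm_le_is_norm[OF assms] by blast
  have "inner z x \<le> norm z * C" if "N x \<le> 1" for x
  proof -
    have "inner z x \<le> norm z * norm x" by (rule norm_cauchy_schwarz)
    also have "\<dots> \<le> norm z * C"
      using C(2)[of x] mult_left_mono[OF that, of C] C(1) by (intro mult_left_mono) (auto intro: order_trans)
    finally show ?thesis .
  qed
  then show ?thesis by (intro bdd_aboveI2[where M = "norm z * C"]) auto
qed

lemma inner_le_dual_norm:
  fixes N :: "'v::euclidean_space \<Rightarrow> real"
  assumes "is_norm N" shows "inner z x \<le> dual_norm N z * N x"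
proof (cases "x = 0")
  case True then show ?thesis by (simp add: is_norm_zero[OF assms])
next
  case False
  then have pos: "0 < N x" by (rule is_norm_pos[OF assms])
  have "inner z ((1 / N x) *\<^sub>R x) \<le> dual_norm N z"
    unfolding dual_norm_def
    by (intro cSUP_upper dual_norm_bdd_above assms) (use pos in \<open>simp add: is_normD(3)[OF assms]\<close>)
  then show ?thesis using pos by (simp add: field_simps)
qed

lemma dual_norm_leI:
  fixes N :: "'v::euclidean_space \<Rightarrow> real"
  assumes "is_norm N" "0 \<le> D" "\<And>x. inner z x \<le> D * N x" shows "dual_norm N z \<le> D"
  unfolding dual_norm_def
proof (rule cSUP_least)
  have "N 0 \<le> 1" by (simp add: is_norm_zero[OF assms(1)])
  then show "{x. N x \<le> 1} \<noteq> {}" by blast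
  fix x assume "x \<in> {x. N x \<le> 1}"
  then show "inner z x \<le> D" using assms(3)[of x] mult_left_mono[of "N x" 1 D] assms(2) by simp
qed

lemma dual_norm_nonneg:
  fixes N :: "'v::euclidean_space \<Rightarrow> real"
  assumes "is_norm N" shows "0 \<le> dual_norm N z"
proof -
  have "inner z 0 \<le> dual_norm N z"
    unfolding dual_norm_def
    by (intro cSUP_upper dual_norm_bdd_above assms) (simp add: is_norm_zero[OF assms])
  then show ?thesis by simp
qed

lemma abs_inner_le_dual_norm:
  fixes N :: "'v::euclidean_space \<Rightarrow> real"
  assumes "is_norm N" shows "\<bar>inner z x\<bar> \<le> dual_norm N z * N x"
  using inner_le_dual_norm[OF assms, of z x] inner_le_dual_norm[OF assms, of z "- x"]
  by (simp add: is_norm_minus[OF assms])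

lemma is_norm_dual_norm:
  fixes N :: "'v::euclidean_space \<Rightarrow> real"
  assumes "is_norm N" shows "is_norm (dual_norm N)"
  unfolding is_norm_def
proof (intro conjI allI)
  note nn = dual_norm_nonneg[OF assms] and holder = inner_le_dual_norm[OF assms]
    and absholder = abs_inner_le_dual_norm[OF assms]
  fix z w :: 'v and c :: real
  show "dual_norm N z = 0 \<longleftrightarrow> z = 0"
  proof
    assume "dual_norm N z = 0"
    then have "inner z z \<le> 0" using holder[of z z] by simp
    then show "z = 0" by (metis inner_eq_zero_iff inner_ge_zero order_antisym)
  qed (use dual_norm_leI[OF assms, of 0 0] nn[of 0] in simp)
  show "dual_norm N (z + w) \<le> dual_norm N z + dual_norm N w"
    using holder by (intro dual_norm_leI assms add_nonneg_nonneg nn)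
      (simp add: inner_add_left distrib_right add_mono)
  have le: "dual_norm N (c *\<^sub>R z) \<le> \<bar>c\<bar> * dual_norm N z" for c z
  proof (intro dual_norm_leI assms mult_nonneg_nonneg nn abs_ge_zero)
    fix x
    have "inner (c *\<^sub>R z) x \<le> \<bar>c\<bar> * \<bar>inner z x\<bar>" by (simp flip: abs_mult)
    also have "\<dots> \<le> \<bar>c\<bar> * (dual_norm N z * N x)" by (intro mult_left_mono absholder) simp
    finally show "inner (c *\<^sub>R z) x \<le> \<bar>c\<bar> * dual_norm N z * N x" by (simp add: mult.assoc)
  qed
  show "dual_norm N (c *\<^sub>R z) = \<bar>c\<bar> * dual_norm N z"
  proof (cases "c = 0")
    case True then show ?thesis using dual_norm_leI[OF assms, of 0 0] nn[of 0] by simp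
  next
    case False
    have "dual_norm N z \<le> \<bar>1 / c\<bar> * dual_norm N (c *\<^sub>R z)"
      using le[of "1 / c" "c *\<^sub>R z"] False by simp
    then have "\<bar>c\<bar> * dual_norm N z \<le> dual_norm N (c *\<^sub>R z)" using False by (simp add: field_simps)
    then show ?thesis using le[of c z] by simp
  qed
qed

text \<open>
  The norm is recovered from its dual norm because the open unit ball and a point of the unit
  sphere are separated by a hyperplane, whose normal vector, suitably scaled, is a norming functional.
\<close>

lemma norming_functional:
  fixes N :: "'v::euclidean_space \<Rightarrow> real"
  assumes "is_norm N"
  obtains z where "dual_norm N z \<le> 1" "inner z p = N p"
proof (cases "p = 0")
  case True
  then show ?thesis
    using that[of 0] is_norm_zero[OF is_norm_dual_norm[OF assms]] is_norm_zero[OF assms] by simp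
next
  case False
  define q where "q = (1 / N p) *\<^sub>R p"
  have pos: "0 < N p" using False by (rule is_norm_pos[OF assms])
  have Nq: "N q = 1" using pos by (simp add: q_def is_normD(3)[OF assms])
  have zero: "0 \<in> {x. N x < 1}" by (simp add: is_norm_zero[OF assms])
  obtain a b where a: "a \<noteq> 0" "\<And>x. N x < 1 \<Longrightarrow> inner a x \<le> b" "b \<le> inner a q"
    using separating_hyperplane_sets[OF is_norm_convex_less[OF assms], of "{q}"] Nq zero by auto
  have "0 \<le> b" using a(2)[of 0] zero by simp
  have le: "inner a x \<le> b * N x" for x
  proof (rule field_le_epsilon)
    fix e :: real assume "0 < e"
    \<comment> \<open>Dividing \<open>x\<close> by slightly more than its norm moves it into the open ball.\<close>
    define e' where "e' = e / (b + 1)"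
    have e': "0 < e'" "b * e' \<le> e" using \<open>0 < e\<close> \<open>0 \<le> b\<close> by (auto simp: e'_def field_simps)
    have t: "0 < N x + e'" using e' is_norm_nonneg[OF assms, of x] by simp
    have "N ((1 / (N x + e')) *\<^sub>R x) < 1" using t e' by (simp add: is_normD(3)[OF assms])
    from a(2)[OF this] have "inner a x \<le> b * (N x + e')" using t by (simp add: field_simps)
    then show "inner a x \<le> b * N x + e" using e' by (simp add: distrib_left)
  qed
  have "0 < inner a a" using a(1) by simp
  also have "\<dots> \<le> b * N a" by (rule le)
  finally have "0 < b" using \<open>0 \<le> b\<close> by (metis mult_zero_left less_eq_real_def)
  have aq: "inner a q = b" using a(3) le[of q] Nq by simp
  have "dual_norm N ((1 / b) *\<^sub>R a) \<le> 1"
    using le \<open>0 < b\<close> by (intro dual_norm_leI assms) (auto simp: field_simps)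
  moreover have "inner ((1 / b) *\<^sub>R a) p = N p"
    using aq pos \<open>0 < b\<close> by (simp add: q_def field_simps)
  ultimately show ?thesis by (rule that)
qed

section \<open>Gradients, smooth convex functions and conjugates\<close>

lemma GDERIV_unique:
  fixes h :: "'v::euclidean_space \<Rightarrow> real"
  assumes "GDERIV h x :> a" "GDERIV h x :> b" shows "a = b"
proof -
  have "(\<lambda>u. inner u a) = (\<lambda>u. inner u b)"
    using assms unfolding gderiv_def by (rule has_derivative_unique)
  then have "inner (a - b) a = inner (a - b) b" by meson
  then have "inner (a - b) (a - b) = 0" by (simp add: inner_diff_right)
  then show ?thesis by simp
qed

lemma grad_eqI:
  fixes h :: "'v::euclidean_space \<Rightarrow> real"
  assumes "GDERIV h x :> a" shows "grad h x = a"
  unfolding grad_def using assms GDERIV_unique by blast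

lemma GDERIV_grad:
  fixes h :: "'v::euclidean_space \<Rightarrow> real"
  assumes "h differentiable (at x)" shows "GDERIV h x :> grad h x"
proof -
  obtain h' where h': "(h has_derivative h') (at x)" using assms unfolding differentiable_def by blast
  interpret bounded_linear h' using h' by (rule has_derivative_bounded_linear)
  have "h' u = inner u (\<Sum>b\<in>Basis. h' b *\<^sub>R b)" for u
  proof -
    have "h' u = h' (\<Sum>b\<in>Basis. (u \<bullet> b) *\<^sub>R b)" by (simp add: euclidean_representation)
    also have "\<dots> = (\<Sum>b\<in>Basis. (u \<bullet> b) * h' b)" by (simp add: sum scaleR)
    finally show ?thesis by (simp add: inner_sum_right mult.commute)
  qed
  then have "h' = (\<lambda>u. inner u (\<Sum>b\<in>Basis. h' b *\<^sub>R b))" by blast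
  with h' have "GDERIV h x :> (\<Sum>b\<in>Basis. h' b *\<^sub>R b)" unfolding gderiv_def by metis
  with grad_eqI[OF this] show ?thesis by simp
qed

lemma DERIV_along_line:
  fixes h :: "'v::euclidean_space \<Rightarrow> real"
  assumes "GDERIV h (x + t *\<^sub>R u) :> a"
  shows "((\<lambda>t. h (x + t *\<^sub>R u)) has_real_derivative inner a u) (at t)"
proof -
  have "((\<lambda>t. x + t *\<^sub>R u) has_derivative (\<lambda>s. s *\<^sub>R u)) (at t)"
    by (auto intro!: derivative_eq_intros)
  from has_derivative_compose[OF this assms[unfolded gderiv_def]]
  have "((\<lambda>t. h (x + t *\<^sub>R u)) has_derivative (\<lambda>s. inner (s *\<^sub>R u) a)) (at t)" .
  moreover have "(\<lambda>s. inner (s *\<^sub>R u) a) = (*) (inner a u)"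
    by (auto simp: inner_commute mult.commute)
  ultimately show ?thesis by (simp add: has_field_derivative_def)
qed

text \<open>
  The difference between the two sides, evaluated along the segment from \<open>x\<close> to \<open>y\<close>, has a derivative
  of constant sign.  Any norm \<open>Q\<close> may measure the displacement; this covers \<open>f\<close> with the
  dual norm as well as the smoothed support function with \<open>N\<close>.
\<close>

lemma smooth_upper_bound:
  fixes h :: "'v::euclidean_space \<Rightarrow> real"
  assumes deriv: "\<And>x. GDERIV h x :> hg x" and Q: "is_norm Q"
    and smooth: "\<And>x y. inner (hg y - hg x) (y - x) \<le> C * (Q (y - x))\<^sup>2"
  shows "h y \<le> h x + inner (hg x) (y - x) + C / 2 * (Q (y - x))\<^sup>2"
proof -
  define u where "u = y - x"
  define F where "F t = h (x + t *\<^sub>R u) - t * inner (hg x) u - t\<^sup>2 * (C / 2 * (Q u)\<^sup>2)" for t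
  have D: "(F has_real_derivative inner (hg (x + t *\<^sub>R u)) u - inner (hg x) u - 2 * t * (C / 2 * (Q u)\<^sup>2)) (at t)" for t
    unfolding F_def by (auto intro!: derivative_eq_intros DERIV_along_line deriv)
  have "F 1 \<le> F 0"
  proof (rule DERIV_nonpos_imp_nonincreasing[of 0 1 F])
    fix t :: real assume "0 \<le> t" "t \<le> 1"
    have "inner (hg (x + t *\<^sub>R u)) u - inner (hg x) u - 2 * t * (C / 2 * (Q u)\<^sup>2) \<le> 0"
    proof (cases "t = 0")
      case False
      have "t * inner (hg (x + t *\<^sub>R u) - hg x) u \<le> t * (t * (C * (Q u)\<^sup>2))"
        using smooth[of "x + t *\<^sub>R u" x] by (simp add: is_normD(3)[OF Q] power2_eq_square mult_ac)
      then have "inner (hg (x + t *\<^sub>R u) - hg x) u \<le> t * (C * (Q u)\<^sup>2)"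
        using False \<open>0 \<le> t\<close> by (simp add: mult_le_cancel_left)
      then show ?thesis by (simp add: inner_diff_left)
    qed simp
    with D show "\<exists>a. (F has_real_derivative a) (at t) \<and> a \<le> 0" by blast
  qed simp
  then show ?thesis by (simp add: F_def u_def)
qed

lemma convex_on_above_gradient:
  fixes h :: "'v::euclidean_space \<Rightarrow> real"
  assumes "convex_on UNIV h" "GDERIV h x :> a"
  shows "h x + inner a (y - x) \<le> h y"
proof -
  define F where "F t = h (x + t *\<^sub>R (y - x))" for t :: real
  have "convex_on UNIV F"
  proof (rule convex_onI)
    fix t s r :: real assume t: "0 < t" "t < 1"
    have "x + ((1 - t) *\<^sub>R s + t *\<^sub>R r) *\<^sub>R (y - x)
        = (1 - t) *\<^sub>R (x + s *\<^sub>R (y - x)) + t *\<^sub>R (x + r *\<^sub>R (y - x))"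
      by (simp add: algebra_simps)
    then show "F ((1 - t) *\<^sub>R s + t *\<^sub>R r) \<le> (1 - t) * F s + t * F r"
      unfolding F_def using convex_onD[OF assms(1), of t] t by (metis UNIV_I less_imp_le)
  qed simp
  moreover have "(F has_real_derivative inner a (y - x)) (at 0)"
    unfolding F_def using assms(2) by (intro DERIV_along_line) simp
  ultimately have "inner a (y - x) * (1 - 0) \<le> F 1 - F 0"
    by (intro convex_on_imp_above_tangent[of UNIV]) auto
  then show ?thesis by (simp add: F_def)
qed

lemma smooth_dual_GDERIV: "smooth_dual N L f \<Longrightarrow> GDERIV f x :> grad f x"
  unfolding smooth_dual_def using GDERIV_grad by blast

lemma smooth_dual_upper_bound:
  fixes f :: "'v::euclidean_space \<Rightarrow> real"
  assumes "is_norm N" "smooth_dual N L f"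
  shows "f y \<le> f x + inner (grad f x) (y - x) + L / 2 * (dual_norm N (y - x))\<^sup>2"
proof (rule smooth_upper_bound)
  fix x y
  have "inner (grad f y - grad f x) (y - x) \<le> dual_norm N (y - x) * N (grad f y - grad f x)"
    using inner_le_dual_norm[OF assms(1), of "y - x" "grad f y - grad f x"] by (simp only: inner_commute)
  also have "\<dots> \<le> dual_norm N (y - x) * (L * dual_norm N (y - x))"
    using assms(2) unfolding smooth_dual_def
    by (intro mult_left_mono dual_norm_nonneg assms(1)) blast
  finally show "inner (grad f y - grad f x) (y - x) \<le> L * (dual_norm N (y - x))\<^sup>2"
    by (simp add: power2_eq_square mult_ac)
qed (auto intro: smooth_dual_GDERIV[OF assms(2)] is_norm_dual_norm assms)

text \<open>
  This is strong convexity of the conjugate \<open>f\<^sup>*\<close> with parameter \<open>1 / L\<close>, read off at the two gradients.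
  The convex function \<open>f - \<langle>\<nabla>f z, _\<rangle>\<close> is minimal at \<open>z\<close>; comparing its minimum with its value after a
  steepest descent step from \<open>x\<close>, in the direction norming \<open>\<nabla>f x - \<nabla>f z\<close>, gives the quadratic term.
\<close>

lemma smooth_convex_cocoercive:
  fixes f :: "'v::euclidean_space \<Rightarrow> real"
  assumes "is_norm N" "convex_on UNIV f" "smooth_dual N L f" "L > 0"
  shows "f z + inner (grad f z) (x - z) + 1 / (2 * L) * (N (grad f x - grad f z))\<^sup>2 \<le> f x"
proof -
  define p where "p = grad f x - grad f z"
  obtain e where e: "dual_norm N e \<le> 1" "inner e p = N p" using norming_functional[OF assms(1)] by blast
  \<comment> \<open>The step length \<open>N p / L\<close> minimizes the quadratic upper model along \<open>- e\<close>.\<close>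
  define u where "u = x - (N p / L) *\<^sub>R e"
  have Np: "0 \<le> N p" by (rule is_norm_nonneg[OF assms(1)])
  have "dual_norm N (u - x) = N p / L * dual_norm N e"
    using Np assms(4) is_norm_minus[OF is_norm_dual_norm[OF assms(1)]]
      is_normD(3)[OF is_norm_dual_norm[OF assms(1)]] by (simp add: u_def)
  also have "\<dots> \<le> N p / L * 1"
    using e Np assms(4) by (intro mult_left_mono) auto
  finally have "(dual_norm N (u - x))\<^sup>2 \<le> (N p / L)\<^sup>2"
    using dual_norm_nonneg[OF assms(1)] by (intro power_mono) auto
  then have "L / 2 * (dual_norm N (u - x))\<^sup>2 \<le> (N p)\<^sup>2 / (2 * L)"
    using assms(4) by (simp add: power_divide field_simps power2_eq_square)
  moreover have "f u \<le> f x + inner (grad f x) (u - x) + L / 2 * (dual_norm N (u - x))\<^sup>2"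
    by (rule smooth_dual_upper_bound[OF assms(1,3)])
  moreover have "f z + inner (grad f z) (u - z) \<le> f u"
    by (rule convex_on_above_gradient[OF assms(2) smooth_dual_GDERIV[OF assms(3)]])
  moreover have "inner (grad f x) (u - x) - inner (grad f z) (u - z)
      = - inner (grad f z) (x - z) - (N p)\<^sup>2 / L"
  proof -
    have "inner (grad f x) (u - x) - inner (grad f z) (u - z)
        = - inner (grad f z) (x - z) - N p / L * inner e p"
      by (simp add: u_def p_def inner_simps inner_commute algebra_simps)
    then show ?thesis by (simp add: e power2_eq_square)
  qed
  moreover have "(N p)\<^sup>2 / L = (N p)\<^sup>2 / (2 * L) + (N p)\<^sup>2 / (2 * L)" by (simp add: field_simps)
  ultimately show ?thesis by (simp add: p_def)
qed

lemma continuous_grad: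
  fixes f :: "'v::euclidean_space \<Rightarrow> real"
  assumes "is_norm N" "smooth_dual N L f" "L > 0"
  shows "continuous_on S (grad f)"
proof -
  obtain C where C: "0 < C" "\<And>x. norm x \<le> C * N x" using norm_le_is_norm[OF assms(1)] by blast
  obtain D where D: "0 < D" "\<And>x. dual_norm N x \<le> D * norm x"
    using is_norm_le_norm[OF is_norm_dual_norm[OF assms(1)]] by blast
  have "(C * (L * D))-lipschitz_on S (grad f)"
  proof (rule lipschitz_onI)
    fix x y
    have "norm (grad f x - grad f y) \<le> C * N (grad f x - grad f y)" by (rule C)
    also have "\<dots> \<le> C * (L * dual_norm N (x - y))"
      using assms(2) C unfolding smooth_dual_def by (intro mult_left_mono) auto
    also have "\<dots> \<le> C * (L * (D * norm (x - y)))"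
      using C D assms(3) by (intro mult_left_mono) auto
    finally show "dist (grad f x) (grad f y) \<le> C * (L * D) * dist x y"
      by (simp add: dist_norm mult.assoc)
  qed (use C D assms in auto)
  then show ?thesis by (rule lipschitz_on_continuous_on)
qed

lemma conjugate_ge: "ereal (inner x y - f x) \<le> conjugate f y"
  unfolding conjugate_def by (rule SUP_upper) simp

lemma conjugate_gradient:
  assumes "convex_on UNIV f" "GDERIV f x :> a"
  shows "conjugate f a = ereal (inner x a - f x)"
proof (rule antisym)
  show "conjugate f a \<le> ereal (inner x a - f x)"
    unfolding conjugate_def
  proof (rule SUP_least)
    fix z
    show "ereal (inner z a - f z) \<le> ereal (inner x a - f x)"
      using convex_on_above_gradient[OF assms, of z] by (simp add: inner_diff_right inner_commute)
  qed
qed (rule conjugate_ge)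

lemma conjugate_convex_bound:
  assumes "conjugate f a \<le> ereal c" "conjugate f b \<le> ereal e" "0 \<le> t" "t \<le> 1"
  shows "conjugate f ((1 - t) *\<^sub>R a + t *\<^sub>R b) \<le> ereal ((1 - t) * c + t * e)"
  unfolding conjugate_def
proof (rule SUP_least)
  fix z
  have "ereal (inner z a - f z) \<le> ereal c" "ereal (inner z b - f z) \<le> ereal e"
    using conjugate_ge[of z a f] conjugate_ge[of z b f] assms(1,2) order_trans by blast+
  then have "(1 - t) * (inner z a - f z) + t * (inner z b - f z) \<le> (1 - t) * c + t * e"
    using assms(3,4) by (intro add_mono mult_left_mono) auto
  then show "ereal (inner z ((1 - t) *\<^sub>R a + t *\<^sub>R b) - f z) \<le> ereal ((1 - t) * c + t * e)"
    by (simp add: inner_simps algebra_simps)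
qed

text \<open>
  The sublevel sets of a supremum of continuous functions are closed.
\<close>

lemma conjugate_measurable [measurable]: "conjugate f \<in> borel_measurable borel"
proof (rule borel_measurableI_le)
  fix c
  have "{y. conjugate f y \<le> c} = (\<Inter>x. {y. ereal (inner x y - f x) \<le> c})"
    unfolding conjugate_def by (auto simp: SUP_le_iff)
  moreover have "closed {y. ereal (inner x y - f x) \<le> c}" for x
    by (intro closed_Collect_le continuous_intros)
  ultimately have "closed {y. conjugate f y \<le> c}" by (simp only: closed_INT ball_UNIV simp_thms)
  then show "{y \<in> space borel. conjugate f y \<le> c} \<in> sets borel" by simp
qed

section \<open>Growth of the cumulative weights\<close>

text \<open>
  The recursion picks the larger root of a quadratic.  The first claim is that quadratic, in the form
  in which \<open>potential_step\<close> needs it; the second bounds the square root of the discriminant below by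
  \<open>2 s A\<close>, which makes the root exceed \<open>A\<close> by a fixed factor.
\<close>

lemma A_seq_Suc_root:
  fixes \<beta> \<mu> :: real and k :: nat
  defines "A \<equiv> A_seq \<beta> \<mu> k" and "A' \<equiv> A_seq \<beta> \<mu> (Suc k)" and "s \<equiv> sqrt (\<mu> * \<beta>)"
  assumes pos: "\<beta> > 0" "\<mu> > 0" and A: "0 \<le> A"
  shows "(A + \<beta>) * \<mu> * A' = \<beta> * (A' - A)\<^sup>2 + s * (A' - A) * A'"
    and "(2 * \<beta> + 3 * s + \<mu>) * A + \<beta> * \<mu> \<le> 2 * (\<beta> + s) * A'"
proof -
  define B where "B = A * (\<mu> + 2 * \<beta> + s) + \<beta> * \<mu>"
  define D where "D = \<mu>\<^sup>2 * (\<beta> + A)\<^sup>2 + 4 * A * \<beta>\<^sup>2 * \<mu> + 5 * A\<^sup>2 * \<mu> * \<beta> + 2 * A * \<mu> * s * (\<beta> + A)"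
  have s: "0 < s" and s2: "s\<^sup>2 = \<mu> * \<beta>" using pos by (auto simp: s_def)
  have A': "A' = (B + sqrt D) / (2 * (\<beta> + s))"
    by (simp add: A'_def A_def B_def D_def s_def Let_def)
  then have cA': "2 * (\<beta> + s) * A' = B + sqrt D" using pos s by simp
  have D4: "(2 * s * A)\<^sup>2 \<le> D"
  proof -
    have "(2 * s * A)\<^sup>2 = 4 * A\<^sup>2 * \<mu> * \<beta>" by (simp add: power_mult_distrib s2)
    also have "\<dots> \<le> 5 * A\<^sup>2 * \<mu> * \<beta>" using pos by simp
    also have "\<dots> \<le> D" using pos A s by (simp add: D_def)
    finally show ?thesis .
  qed
  then have "0 \<le> D" by (meson order_trans zero_le_power2)
  then have sq: "(sqrt D)\<^sup>2 = D" by simp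
  have DB: "D = B\<^sup>2 - 4 * (\<beta> + s) * (\<beta> * A\<^sup>2)"
  proof -
    have "B\<^sup>2 - 4 * (\<beta> + s) * (\<beta> * A\<^sup>2) - D = (A\<^sup>2) * (s\<^sup>2 - \<mu> * \<beta>)"
      by (simp add: B_def D_def power2_eq_square algebra_simps)
    then show ?thesis by (simp add: s2)
  qed
  have "4 * (\<beta> + s) * ((\<beta> + s) * A'\<^sup>2 - B * A' + \<beta> * A\<^sup>2)
      = (2 * (\<beta> + s) * A')\<^sup>2 - 2 * B * (2 * (\<beta> + s) * A') + 4 * (\<beta> + s) * (\<beta> * A\<^sup>2)"
    by (simp add: power2_eq_square algebra_simps)
  also have "\<dots> = 0" unfolding cA' using sq DB by (simp add: power2_eq_square algebra_simps)
  finally have "(\<beta> + s) * A'\<^sup>2 - B * A' + \<beta> * A\<^sup>2 = 0" using pos s by simp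
  then show "(A + \<beta>) * \<mu> * A' = \<beta> * (A' - A)\<^sup>2 + s * (A' - A) * A'"
    by (simp add: B_def power2_eq_square algebra_simps)
  have "2 * s * A \<le> sqrt D" using D4 by (rule real_le_rsqrt)
  then show "(2 * \<beta> + 3 * s + \<mu>) * A + \<beta> * \<mu> \<le> 2 * (\<beta> + s) * A'"
    unfolding cA' B_def by (simp add: algebra_simps)
qed

lemma A_seq_nonneg:
  assumes "\<beta> > 0" "\<mu> > 0" shows "0 \<le> A_seq \<beta> \<mu> k"
proof (induction k)
  case (Suc k)
  have "0 \<le> (2 * \<beta> + 3 * sqrt (\<mu> * \<beta>) + \<mu>) * A_seq \<beta> \<mu> k + \<beta> * \<mu>"
    using assms Suc by simp
  also have "\<dots> \<le> 2 * (\<beta> + sqrt (\<mu> * \<beta>)) * A_seq \<beta> \<mu> (Suc k)"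
    by (rule A_seq_Suc_root(2)[OF assms Suc])
  finally show ?case
    using assms by (metis zero_le_mult_iff add_pos_pos real_sqrt_gt_zero mult_pos_pos not_less zero_less_numeral)
qed simp

lemma A_seq_Suc_ge:
  assumes "\<beta> > 0" "\<mu> > 0"
  shows "(1 + sqrt (\<mu> / \<beta>) / 2) * A_seq \<beta> \<mu> k < A_seq \<beta> \<mu> (Suc k)"
proof -
  define s q where "s = sqrt (\<mu> * \<beta>)" and "q = sqrt (\<mu> / \<beta>)"
  have qb: "q * \<beta> = s" and qs: "q * s = \<mu>"
    using assms by (simp_all add: q_def s_def real_sqrt_mult real_sqrt_divide field_simps)
  have s: "0 < s" using assms by (simp add: s_def)
  have "2 * (\<beta> + s) * ((1 + q / 2) * A_seq \<beta> \<mu> k)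
      = (2 * \<beta> + 2 * s + q * \<beta> + q * s) * A_seq \<beta> \<mu> k"
    by (simp add: algebra_simps)
  also have "\<dots> = (2 * \<beta> + 3 * s + \<mu>) * A_seq \<beta> \<mu> k" by (simp add: qb qs)
  also have "\<dots> < (2 * \<beta> + 3 * s + \<mu>) * A_seq \<beta> \<mu> k + \<beta> * \<mu>" using assms by simp
  also have "\<dots> \<le> 2 * (\<beta> + s) * A_seq \<beta> \<mu> (Suc k)"
    unfolding s_def by (rule A_seq_Suc_root(2)[OF assms A_seq_nonneg[OF assms]])
  finally show ?thesis using assms s by (simp add: q_def)
qed

lemma A_seq_strict_mono:
  assumes "\<beta> > 0" "\<mu> > 0" shows "A_seq \<beta> \<mu> k < A_seq \<beta> \<mu> (Suc k)"
proof -
  have "1 * A_seq \<beta> \<mu> k \<le> (1 + sqrt (\<mu> / \<beta>) / 2) * A_seq \<beta> \<mu> k"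
    using assms by (intro mult_right_mono A_seq_nonneg) auto
  then show ?thesis using A_seq_Suc_ge[OF assms, of k] by simp
qed

text \<open>
  Each step multiplies by at least \<open>1 + q / 2 \<ge> exp (q / 8)\<close> with \<open>q = sqrt (\<mu> / \<beta>) \<le> 1\<close>, and the
  first value \<open>\<beta> \<mu> / (\<beta> + sqrt (\<mu> \<beta>))\<close> is at least \<open>\<mu> / 2\<close>.
\<close>

lemma A_seq_growth:
  assumes "\<mu> > 0" "\<mu> \<le> \<beta>"
  shows "\<mu> / 2 * exp (real k * (sqrt (\<mu> / \<beta>) / 8)) \<le> A_seq \<beta> \<mu> (Suc k)"
proof (induction k)
  case 0
  have pos: "0 < \<beta>" using assms by simp
  have "sqrt (\<mu> * \<beta>) \<le> sqrt (\<beta> * \<beta>)" using assms pos by (intro real_sqrt_le_mono mult_right_mono) auto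
  then have s: "0 < sqrt (\<mu> * \<beta>)" "sqrt (\<mu> * \<beta>) \<le> \<beta>" using assms pos by auto
  have "A_seq \<beta> \<mu> (Suc 0) = 2 * (\<beta> * \<mu>) / (2 * (\<beta> + sqrt (\<mu> * \<beta>)))"
    using assms pos by (simp add: real_sqrt_mult Let_def flip: power_mult_distrib)
  also have "\<dots> \<ge> 2 * (\<beta> * \<mu>) / (2 * (\<beta> + \<beta>))"
    using s pos assms by (intro divide_left_mono mult_left_mono add_mono mult_pos_pos add_pos_pos) auto
  finally show ?case using pos by simp
next
  case (Suc k)
  have pos: "0 < \<beta>" using assms by simp
  define q where "q = sqrt (\<mu> / \<beta>)"
  have q: "0 \<le> q" "q \<le> 1" using assms pos by (auto simp: q_def)
  have "exp (q / 8) \<le> 1 + q / 8 + (q / 8)\<^sup>2" using q by (intro exp_bound) auto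
  also have "(q / 8)\<^sup>2 \<le> q / 8" using q mult_left_le[of q q] by (simp add: power2_eq_square)
  finally have e: "exp (q / 8) \<le> 1 + q / 2" using q by simp
  have "\<mu> / 2 * exp (real (Suc k) * (q / 8)) = exp (q / 8) * (\<mu> / 2 * exp (real k * (q / 8)))"
    by (simp add: distrib_right add_divide_distrib exp_add)
  also have "\<dots> \<le> (1 + q / 2) * A_seq \<beta> \<mu> (Suc k)"
    using Suc e q A_seq_nonneg[OF pos assms(1)] by (intro mult_mono) (auto simp: q_def assms(1) less_imp_le)
  also have "\<dots> \<le> A_seq \<beta> \<mu> (Suc (Suc k))"
    unfolding q_def by (intro less_imp_le A_seq_Suc_ge pos assms)
  finally show ?case by (simp add: q_def)
qed

text \<open>From here on only the consequences of the recursion matter.\<close>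

declare A_seq.simps(2) [simp del]

section \<open>Translations of a differentiable density\<close>

lemma nn_integral_lborel_translate:
  fixes F :: "'v::euclidean_space \<Rightarrow> ennreal"
  assumes [measurable]: "F \<in> borel_measurable borel"
  shows "(\<integral>\<^sup>+z. F (c + z) \<partial>lborel) = (\<integral>\<^sup>+z. F z \<partial>lborel)"
proof -
  have "(\<integral>\<^sup>+z. F z \<partial>lborel) = (\<integral>\<^sup>+z. F z \<partial>distr lborel borel ((+) c))"
    by (simp only: lborel_distr_plus)
  also have "\<dots> = (\<integral>\<^sup>+z. F (c + z) \<partial>lborel)" by (rule nn_integral_distr) simp_all
  finally show ?thesis by simp
qed

lemma integral_lborel_translate:
  fixes F :: "'v::euclidean_space \<Rightarrow> real"
  assumes [measurable]: "F \<in> borel_measurable borel"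
  shows "(\<integral>z. F (c + z) \<partial>lborel) = (\<integral>z. F z \<partial>lborel)"
proof -
  have "(\<integral>z. F z \<partial>lborel) = (\<integral>z. F z \<partial>distr lborel borel ((+) c))"
    by (simp only: lborel_distr_plus)
  also have "\<dots> = (\<integral>z. F (c + z) \<partial>lborel)" by (rule integral_distr) simp_all
  finally show ?thesis by simp
qed

lemma integrable_lborel_translate:
  fixes F :: "'v::euclidean_space \<Rightarrow> real"
  assumes "integrable lborel F"
  shows "integrable lborel (\<lambda>z. F (c + z))"
proof -
  have "integrable (distr lborel borel ((+) c)) F" using assms by (simp only: lborel_distr_plus)
  then show ?thesis by (rule integrable_distr[rotated]) simp
qed

text \<open>
  If the integral diverges there is nothing to prove; otherwise the gauge integral, for which the
  fundamental theorem holds for every derivative, coincides with the Lebesgue integral.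
\<close>

lemma DERIV_variation_le:
  fixes F :: "real \<Rightarrow> real"
  assumes deriv: "\<And>t. (F has_real_derivative F' t) (at t)" and [measurable]: "F' \<in> borel_measurable borel"
  shows "ennreal \<bar>F 1 - F 0\<bar> \<le> (\<integral>\<^sup>+t\<in>{0..1}. ennreal \<bar>F' t\<bar> \<partial>lborel)"
proof (cases "(\<integral>\<^sup>+t\<in>{0..1}. ennreal \<bar>F' t\<bar> \<partial>lborel) = \<infinity>")
  case False
  have eq: "(\<integral>\<^sup>+t\<in>{0..1}. ennreal \<bar>F' t\<bar> \<partial>lborel)
      = (\<integral>\<^sup>+t. ennreal (norm (indicator {0..1} t *\<^sub>R F' t)) \<partial>lborel)"
    by (intro nn_integral_cong) (simp split: split_indicator)
  have int: "set_integrable lborel {0..1} F'"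
    unfolding set_integrable_def
  proof (rule integrableI_bounded)
    show "(\<integral>\<^sup>+t. ennreal (norm (indicator {0..1} t *\<^sub>R F' t)) \<partial>lborel) < \<infinity>"
      using False unfolding eq by (simp add: less_top)
  qed simp
  have "(F' has_integral F 1 - F 0) {0..1}"
    using deriv by (intro fundamental_theorem_of_calculus)
      (auto simp: has_real_derivative_iff_has_vector_derivative intro: has_vector_derivative_at_within)
  then have "F 1 - F 0 = (LINT t:{0..1}|lborel. F' t)"
    using set_borel_integral_eq_integral(2)[OF int] by (simp add: integral_unique)
  also have "ennreal \<bar>\<dots>\<bar> \<le> (\<integral>\<^sup>+t. ennreal (norm (indicator {0..1} t *\<^sub>R F' t)) \<partial>lborel)"
    using integral_norm_bound_ennreal[of lborel "\<lambda>t. indicator {0..1} t *\<^sub>R F' t"] int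
    unfolding set_integrable_def set_lebesgue_integral_def by simp
  finally show ?thesis unfolding eq .
qed simp

lemma GDERIV_continuous:
  assumes "\<And>u. GDERIV p u :> Dp u" shows "continuous_on S p"
  using assms unfolding gderiv_def
  by (meson continuous_at_imp_continuous_on has_derivative_continuous)

text \<open>
  A directional derivative is a pointwise limit of continuous difference quotients.
\<close>

lemma GDERIV_inner_measurable:
  fixes p :: "'v::euclidean_space \<Rightarrow> real"
  assumes "\<And>u. GDERIV p u :> Dp u"
  shows "(\<lambda>u. inner (Dp u) h) \<in> borel_measurable borel"
proof (rule borel_measurable_LIMSEQ_real)
  have [measurable]: "p \<in> borel_measurable borel"
    by (intro borel_measurable_continuous_onI GDERIV_continuous[OF assms])
  show "(\<lambda>u. (p (u + inverse (real (Suc n)) *\<^sub>R h) - p u) / inverse (real (Suc n)))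
      \<in> borel_measurable borel" for n
    by measurable
  fix u
  have "((\<lambda>t. p (u + t *\<^sub>R h)) has_real_derivative inner (Dp u) h) (at 0)"
    using assms by (intro DERIV_along_line) simp
  then have "((\<lambda>t. (p (u + t *\<^sub>R h) - p u) / t) \<longlongrightarrow> inner (Dp u) h) (at 0)"
    by (simp add: DERIV_def)
  moreover have "filterlim (\<lambda>n. inverse (real (Suc n))) (at 0) sequentially"
    using LIMSEQ_inverse_real_of_nat by (intro filterlim_atI) auto
  ultimately show "(\<lambda>n. (p (u + inverse (real (Suc n)) *\<^sub>R h) - p u) / inverse (real (Suc n)))
      \<longlonglongrightarrow> inner (Dp u) h"
    by (rule filterlim_compose)
qed

text \<open>
  On each segment the increment is bounded by the integral of the directional derivative.  After
  exchanging the integrals, the translation invariance of the Lebesgue measure makes the inner integral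
  independent of the position on the segment.
\<close>

lemma nn_integral_translation_diff_le:
  fixes p :: "'v::euclidean_space \<Rightarrow> real"
  assumes deriv: "\<And>u. GDERIV p u :> Dp u"
  shows "(\<integral>\<^sup>+u. ennreal \<bar>p (u + h) - p u\<bar> \<partial>lborel) \<le> (\<integral>\<^sup>+u. ennreal \<bar>inner (Dp u) h\<bar> \<partial>lborel)"
proof -
  have [measurable]: "(\<lambda>u. inner (Dp u) h) \<in> borel_measurable borel"
    by (rule GDERIV_inner_measurable[OF deriv])
  have [measurable]: "(\<lambda>x. inner (Dp (g x)) h) \<in> borel_measurable X"
    if [measurable]: "g \<in> borel_measurable X" for g :: "'b \<Rightarrow> 'v" and X
    using measurable_compose[OF that, of "\<lambda>u. inner (Dp u) h"] by simp
  have "(\<integral>\<^sup>+u. ennreal \<bar>p (u + h) - p u\<bar> \<partial>lborel)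
      \<le> (\<integral>\<^sup>+u. (\<integral>\<^sup>+t\<in>{0..1::real}. ennreal \<bar>inner (Dp (u + t *\<^sub>R h)) h\<bar> \<partial>lborel) \<partial>lborel)"
  proof (rule nn_integral_mono)
    fix u
    show "ennreal \<bar>p (u + h) - p u\<bar> \<le> (\<integral>\<^sup>+t\<in>{0..1::real}. ennreal \<bar>inner (Dp (u + t *\<^sub>R h)) h\<bar> \<partial>lborel)"
      using DERIV_variation_le[of "\<lambda>t. p (u + t *\<^sub>R h)" "\<lambda>t. inner (Dp (u + t *\<^sub>R h)) h"]
      by (simp add: DERIV_along_line deriv)
  qed
  also have "\<dots> = (\<integral>\<^sup>+t\<in>{0..1::real}. (\<integral>\<^sup>+u. ennreal \<bar>inner (Dp (t *\<^sub>R h + u)) h\<bar> \<partial>lborel) \<partial>lborel)"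
    by (subst lborel_pair.Fubini') (simp_all add: nn_integral_multc add.commute)
  also have "\<dots> = (\<integral>\<^sup>+t\<in>{0..1::real}. (\<integral>\<^sup>+u. ennreal \<bar>inner (Dp u) h\<bar> \<partial>lborel) \<partial>lborel)"
    using nn_integral_lborel_translate[of "\<lambda>u. ennreal \<bar>inner (Dp u) h\<bar>"] by simp
  also have "\<dots> = (\<integral>\<^sup>+u. ennreal \<bar>inner (Dp u) h\<bar> \<partial>lborel)"
    by (simp add: nn_integral_cmult)
  finally show ?thesis .
qed

section \<open>The smoothed support function\<close>

text \<open>
  Everything that concerns the perturbed linear maximization alone, apart from the algorithm.
\<close>

locale perturbed_argmax =
  fixes N :: "'v::euclidean_space \<Rightarrow> real" and K :: "'v set" and \<eta> :: "'v \<Rightarrow> real"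
    and \<alpha> R M :: real and lmo :: "'v \<Rightarrow> 'v"
  assumes norm: "is_norm N" and compact: "compact K"
    and R: "R = (SUP u\<in>K. dual_norm N u)"
    and eta_differentiable: "\<And>z. \<eta> differentiable (at z)"
    and prob_noise: "prob_space (noise_law \<eta>)"
    and M: "integrable (noise_law \<eta>) (\<lambda>z. (dual_norm N (grad \<eta> z))\<^sup>2)"
      "M = sqrt (\<integral>z. (dual_norm N (grad \<eta> z))\<^sup>2 \<partial>noise_law \<eta>)"
    and support_integrable: "integrable (noise_law \<eta>) (support_fun K)"
    and alpha: "\<alpha> > 0"
    and lmo: "lin_max_selection K lmo"
begin

sublocale noise: prob_space "noise_law \<eta>" by (rule prob_noise)

definition mean_argmax :: "'v \<Rightarrow> 'v" where
  "mean_argmax y = (\<integral>z. lmo (y + \<alpha> *\<^sub>R z) \<partial>noise_law \<eta>)"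

lemma lmo_in: "lmo w \<in> K"
  using lmo unfolding lin_max_selection_def is_arg_max_def by blast

lemma lmo_measurable [measurable]: "lmo \<in> borel_measurable borel"
  using lmo unfolding lin_max_selection_def by blast

lemma lmo_max: "u \<in> K \<Longrightarrow> inner u w \<le> inner (lmo w) w"
  using lmo unfolding lin_max_selection_def is_arg_max_def by (meson not_less)

text \<open>
  The selection turns the supremum into an attained maximum; measurability of the support function and
  all of its inequalities below follow from this formula.
\<close>

lemma support_fun_lmo: "support_fun K w = inner (lmo w) w"
  unfolding support_fun_def
proof (rule antisym)
  show "(SUP u\<in>K. inner u w) \<le> inner (lmo w) w"
    by (rule cSUP_least) (use lmo_in lmo_max in auto)
  show "inner (lmo w) w \<le> (SUP u\<in>K. inner u w)"
    by (rule cSUP_upper[OF lmo_in]) (use lmo_max in \<open>auto intro!: bdd_aboveI2\<close>)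
qed

lemma inner_le_support_fun: "u \<in> K \<Longrightarrow> inner u w \<le> support_fun K w"
  using lmo_max by (simp add: support_fun_lmo)

lemma support_fun_measurable [measurable]: "support_fun K \<in> borel_measurable borel"
  unfolding support_fun_lmo by measurable

lemma support_fun_scaleR: "0 \<le> c \<Longrightarrow> support_fun K (c *\<^sub>R w) = c * support_fun K w"
  using inner_le_support_fun[OF lmo_in, of "c *\<^sub>R w" w] inner_le_support_fun[OF lmo_in, of w "c *\<^sub>R w"]
  by (intro antisym) (simp_all add: support_fun_lmo mult_left_mono)

lemma dual_norm_le_R: "u \<in> K \<Longrightarrow> dual_norm N u \<le> R"
  unfolding R using compact
  by (intro cSUP_upper) (auto intro!: bounded_imp_bdd_above compact_imp_bounded
      compact_continuous_image is_norm_continuous is_norm_dual_norm norm)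

lemma R_nonneg: "0 \<le> R"
  using dual_norm_le_R[OF lmo_in] dual_norm_nonneg[OF norm] order_trans by blast

lemma K_bounded: obtains B where "0 < B" "\<And>u. u \<in> K \<Longrightarrow> norm u \<le> B"
  using compact_imp_bounded[OF compact] bounded_pos by blast

text \<open>
  Used to compare \<open>s (y + \<alpha> z)\<close> with \<open>s (\<alpha> z) = \<alpha> s z\<close> uniformly in \<open>z\<close>, so that integrability of the
  support function under the noise carries over to every perturbed argument.
\<close>

lemma support_fun_translate:
  assumes "\<And>u. u \<in> K \<Longrightarrow> norm u \<le> B"
  shows "\<bar>support_fun K (a + b) - support_fun K b\<bar> \<le> B * norm a"
proof -
  have cs: "\<bar>inner (lmo w) a\<bar> \<le> B * norm a" for w
    using Cauchy_Schwarz_ineq2[of "lmo w" a] mult_right_mono[OF assms[OF lmo_in], of "norm a" w] by simp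
  show ?thesis
    using inner_le_support_fun[OF lmo_in, of b "a + b"] inner_le_support_fun[OF lmo_in, of "a + b" b]
      cs[of "a + b"] cs[of b]
    by (simp add: support_fun_lmo inner_add_right abs_le_iff)
qed

lemma measurable_noise [simp]: "borel_measurable (noise_law \<eta>) = borel_measurable borel"
  by (simp add: noise_law_def measurable_def)

lemma perturbed_support_integrable:
  "integrable (noise_law \<eta>) (\<lambda>z. support_fun K (y + \<alpha> *\<^sub>R z))"
proof -
  obtain B where B: "0 < B" "\<And>u. u \<in> K \<Longrightarrow> norm u \<le> B" using K_bounded by blast
  have diff: "integrable (noise_law \<eta>) (\<lambda>z. support_fun K (y + \<alpha> *\<^sub>R z) - support_fun K (\<alpha> *\<^sub>R z))"
    using support_fun_translate[OF B(2)] by (intro noise.integrable_const_bound[where B = "B * norm y"]) auto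
  have scaled: "integrable (noise_law \<eta>) (\<lambda>z. support_fun K (\<alpha> *\<^sub>R z))"
    using support_integrable alpha by (simp add: support_fun_scaleR)
  from Bochner_Integration.integrable_add[OF diff scaled] show ?thesis by simp
qed

lemma lmo_integrable: "integrable (noise_law \<eta>) (\<lambda>z. lmo (y + \<alpha> *\<^sub>R z))"
proof -
  obtain B where B: "0 < B" "\<And>u. u \<in> K \<Longrightarrow> norm u \<le> B" using K_bounded by blast
  show ?thesis
    using B lmo_in by (intro noise.integrable_const_bound[where B = B]) auto
qed

lemma inner_mean_argmax:
  "inner (mean_argmax y) x = (\<integral>z. inner (lmo (y + \<alpha> *\<^sub>R z)) x \<partial>noise_law \<eta>)"
  unfolding mean_argmax_def using lmo_integrable by simp

lemma abs_inner_mean_argmax_le: "\<bar>inner (mean_argmax y) x\<bar> \<le> R * N x"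
proof -
  have "\<bar>inner (lmo w) x\<bar> \<le> R * N x" for w
    using abs_inner_le_dual_norm[OF norm, of "lmo w" x]
      mult_right_mono[OF dual_norm_le_R[OF lmo_in] is_norm_nonneg[OF norm], of w x] by simp
  then have "(\<integral>z. \<bar>inner (lmo (y + \<alpha> *\<^sub>R z)) x\<bar> \<partial>noise_law \<eta>) \<le> (\<integral>z. R * N x \<partial>noise_law \<eta>)"
    using lmo_integrable by (intro integral_mono) auto
  then have "\<bar>\<integral>z. inner (lmo (y + \<alpha> *\<^sub>R z)) x \<partial>noise_law \<eta>\<bar> \<le> (\<integral>z. R * N x \<partial>noise_law \<eta>)"
    by (rule order_trans[OF integral_abs_bound])
  then show ?thesis by (simp add: inner_mean_argmax noise.prob_space)
qed

lemma score_measurable [measurable]: "(\<lambda>z. dual_norm N (grad \<eta> z)) \<in> borel_measurable borel"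
proof -
  have "(\<lambda>z. (dual_norm N (grad \<eta> z))\<^sup>2) \<in> borel_measurable borel"
    using M(1)[THEN borel_measurable_integrable] by simp
  from measurable_compose[OF this borel_measurable_sqrt]
  show ?thesis by (simp add: dual_norm_nonneg[OF norm])
qed

text \<open>
  By the Cauchy--Schwarz inequality the first moment of the score \<open>\<nabla>\<eta>\<close> is at most the root \<open>M\<close> of its
  second moment.
\<close>

lemma score_mean_le: "(\<integral>\<^sup>+z. ennreal (dual_norm N (grad \<eta> z)) \<partial>noise_law \<eta>) \<le> ennreal M"
proof -
  let ?q = "\<lambda>z. dual_norm N (grad \<eta> z)"
  have nn: "0 \<le> ?q z" for z by (rule dual_norm_nonneg[OF norm])
  have int: "integrable (noise_law \<eta>) ?q"
  proof (rule Bochner_Integration.integrable_bound)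
    show "integrable (noise_law \<eta>) (\<lambda>z. 1 + (?q z)\<^sup>2)" using M(1) by simp
    have "t \<le> 1 + t\<^sup>2" for t :: real using zero_le_power2[of "t - 1/2"] by (simp add: power2_eq_square algebra_simps)
    then show "AE z in noise_law \<eta>. norm (?q z) \<le> norm (1 + (?q z)\<^sup>2)" using nn by simp
  qed simp
  have "(\<integral>z. ?q z \<partial>noise_law \<eta>)\<^sup>2 \<le> (\<integral>z. (?q z)\<^sup>2 \<partial>noise_law \<eta>)"
    using noise.variance_eq[OF int M(1)] noise.variance_positive[of ?q] by simp
  then have "(\<integral>z. ?q z \<partial>noise_law \<eta>) \<le> M" unfolding M(2) by (rule real_le_rsqrt)
  then show ?thesis using int nn by (simp add: nn_integral_eq_integral ennreal_leI)
qed

lemma noise_density_nonneg: "0 \<le> noise_density \<eta> z"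
  by (simp add: noise_density_def)

lemma GDERIV_noise_density:
  "GDERIV (noise_density \<eta>) z :> (- noise_density \<eta> z) *\<^sub>R grad \<eta> z"
proof -
  have "DERIV (\<lambda>t. exp (- t) / (\<integral>u. exp (- \<eta> u) \<partial>lborel)) (\<eta> z) :> - noise_density \<eta> z"
  proof -
    have "DERIV (\<lambda>t. exp (- t)) (\<eta> z) :> - exp (- \<eta> z)" by (auto intro!: derivative_eq_intros)
    from DERIV_cdivide[OF this] show ?thesis by (simp add: noise_density_def)
  qed
  from GDERIV_DERIV_compose[OF GDERIV_grad[OF eta_differentiable] this]
  show ?thesis unfolding noise_density_def[abs_def] by simp
qed

lemma noise_density_measurable [measurable]: "noise_density \<eta> \<in> borel_measurable borel"
  by (intro borel_measurable_continuous_onI GDERIV_continuous[OF GDERIV_noise_density])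

lemma nn_integral_noise:
  "g \<in> borel_measurable borel \<Longrightarrow>
    (\<integral>\<^sup>+z. g z \<partial>noise_law \<eta>) = (\<integral>\<^sup>+z. ennreal (noise_density \<eta> z) * g z \<partial>lborel)"
  unfolding noise_law_def by (rule nn_integral_density) auto

lemma noise_density_integrable: "integrable lborel (noise_density \<eta>)"
proof (rule integrableI_nonneg)
  have "(\<integral>\<^sup>+z. ennreal (noise_density \<eta> z) \<partial>lborel) = 1"
    using nn_integral_noise[of "\<lambda>_. 1"] noise.emeasure_space_1 by simp
  then show "(\<integral>\<^sup>+z. ennreal (noise_density \<eta> z) \<partial>lborel) < \<infinity>" by simp
qed (simp_all add: noise_density_nonneg)

text \<open>
  The gradient of the density \<open>p\<close> is \<open>- p \<nabla>\<eta>\<close>, so its \<open>L\<^sup>1\<close> norm is the first moment of the score.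
\<close>

lemma noise_density_translation:
  "(\<integral>u. \<bar>noise_density \<eta> (c + u) - noise_density \<eta> (c' + u)\<bar> \<partial>lborel) \<le> N (c - c') * M"
proof -
  let ?p = "noise_density \<eta>"
  let ?F = "\<lambda>u. \<bar>?p (u + (c - c')) - ?p u\<bar>"
  have Nnn: "0 \<le> N (c - c')" by (rule is_norm_nonneg[OF norm])
  have M0: "0 \<le> M" unfolding M(2) by simp
  have eq: "(\<integral>u. \<bar>?p (c + u) - ?p (c' + u)\<bar> \<partial>lborel) = (\<integral>u. ?F u \<partial>lborel)"
    using integral_lborel_translate[of ?F c'] by (simp add: algebra_simps)
  have "integrable lborel ?F"
    using integrable_lborel_translate[OF noise_density_integrable, of "c - c'"] noise_density_integrable
    by (simp add: add.commute)
  then have "ennreal (\<integral>u. ?F u \<partial>lborel) = (\<integral>\<^sup>+u. ennreal (?F u) \<partial>lborel)"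
    by (simp add: nn_integral_eq_integral)
  also have "\<dots> \<le> (\<integral>\<^sup>+u. ennreal \<bar>inner ((- ?p u) *\<^sub>R grad \<eta> u) (c - c')\<bar> \<partial>lborel)"
    by (rule nn_integral_translation_diff_le[OF GDERIV_noise_density])
  also have "\<dots> \<le> (\<integral>\<^sup>+u. ennreal (?p u) * (ennreal (N (c - c')) * ennreal (dual_norm N (grad \<eta> u))) \<partial>lborel)"
  proof (rule nn_integral_mono)
    fix u
    have "\<bar>inner ((- ?p u) *\<^sub>R grad \<eta> u) (c - c')\<bar> \<le> ?p u * (N (c - c') * dual_norm N (grad \<eta> u))"
      using mult_left_mono[OF abs_inner_le_dual_norm[OF norm, of "grad \<eta> u" "c - c'"] noise_density_nonneg[of u]]
        noise_density_nonneg[of u] by (simp add: abs_mult mult_ac)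
    then show "ennreal \<bar>inner ((- ?p u) *\<^sub>R grad \<eta> u) (c - c')\<bar>
        \<le> ennreal (?p u) * (ennreal (N (c - c')) * ennreal (dual_norm N (grad \<eta> u)))"
      using Nnn noise_density_nonneg[of u] dual_norm_nonneg[OF norm, of "grad \<eta> u"]
      by (simp flip: ennreal_mult)
  qed
  also have "\<dots> = (\<integral>\<^sup>+u. ennreal (N (c - c')) * ennreal (dual_norm N (grad \<eta> u)) \<partial>noise_law \<eta>)"
    by (rule nn_integral_noise[symmetric]) simp
  also have "\<dots> = ennreal (N (c - c')) * (\<integral>\<^sup>+u. ennreal (dual_norm N (grad \<eta> u)) \<partial>noise_law \<eta>)"
    by (rule nn_integral_cmult) simp
  also have "\<dots> \<le> ennreal (N (c - c')) * ennreal M"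
    by (rule mult_left_mono[OF score_mean_le]) simp
  also have "\<dots> = ennreal (N (c - c') * M)" using Nnn M0 by (simp add: ennreal_mult)
  finally have "(\<integral>u. ?F u \<partial>lborel) \<le> N (c - c') * M"
    using Nnn M0 by (simp add: ennreal_le_iff)
  then show ?thesis by (simp add: eq)
qed

text \<open>
  Substituting \<open>z = u - y / \<alpha>\<close> moves the dependence on \<open>y\<close> from the discontinuous selection to the
  density.
\<close>

lemma inner_mean_argmax_density:
  "inner (mean_argmax y) x
    = (\<integral>u. noise_density \<eta> ((- (1 / \<alpha>) *\<^sub>R y) + u) * inner (lmo (\<alpha> *\<^sub>R u)) x \<partial>lborel)"
proof -
  let ?F = "\<lambda>z. noise_density \<eta> z * inner (lmo (y + \<alpha> *\<^sub>R z)) x"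
  have shift: "y + \<alpha> *\<^sub>R (- (1 / \<alpha>) *\<^sub>R y + u) = \<alpha> *\<^sub>R u" for u
    using alpha by (simp add: scaleR_add_right scaleR_diff_right)
  have "inner (mean_argmax y) x = (\<integral>z. ?F z \<partial>lborel)"
    unfolding inner_mean_argmax noise_law_def using noise_density_nonneg
    by (subst integral_density) auto
  also have "\<dots> = (\<integral>u. ?F (- (1 / \<alpha>) *\<^sub>R y + u) \<partial>lborel)"
    by (rule integral_lborel_translate[symmetric]) simp
  also have "\<dots> = (\<integral>u. noise_density \<eta> ((- (1 / \<alpha>) *\<^sub>R y) + u) * inner (lmo (\<alpha> *\<^sub>R u)) x \<partial>lborel)"
    by (simp only: shift)
  finally show ?thesis .
qed

text \<open>
  Both means integrate the same function, bounded by \<open>R N x\<close>, against two translates of the density.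
\<close>

lemma mean_argmax_lipschitz:
  "inner (mean_argmax y - mean_argmax y') x \<le> R * M / \<alpha> * N (y - y') * N x"
proof -
  define c c' where "c = - (1 / \<alpha>) *\<^sub>R y" and "c' = - (1 / \<alpha>) *\<^sub>R y'"
  let ?p = "noise_density \<eta>" and ?l = "\<lambda>u. inner (lmo (\<alpha> *\<^sub>R u)) x"
  have l: "\<bar>?l u\<bar> \<le> R * N x" for u
    using abs_inner_le_dual_norm[OF norm, of "lmo (\<alpha> *\<^sub>R u)" x]
      mult_right_mono[OF dual_norm_le_R[OF lmo_in] is_norm_nonneg[OF norm], of "\<alpha> *\<^sub>R u" x] by simp
  have p_int: "integrable lborel (\<lambda>u. ?p (b + u))" for b
    by (rule integrable_lborel_translate[OF noise_density_integrable])
  have int: "integrable lborel (\<lambda>u. ?p (b + u) * ?l u)" for b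
  proof (rule Bochner_Integration.integrable_bound)
    show "integrable lborel (\<lambda>u. R * N x * ?p (b + u))" using p_int by simp
    show "AE u in lborel. norm (?p (b + u) * ?l u) \<le> norm (R * N x * ?p (b + u))"
      using l noise_density_nonneg R_nonneg is_norm_nonneg[OF norm]
      by (auto simp: abs_mult intro!: AE_I2) (metis mult.commute mult_left_mono)
  qed simp
  have "inner (mean_argmax y - mean_argmax y') x = (\<integral>u. ?p (c + u) * ?l u - ?p (c' + u) * ?l u \<partial>lborel)"
    unfolding inner_diff_left inner_mean_argmax_density
    by (subst Bochner_Integration.integral_diff[OF int int]) (simp add: c_def c'_def)
  also have "\<dots> \<le> (\<integral>u. R * N x * \<bar>?p (c + u) - ?p (c' + u)\<bar> \<partial>lborel)"
  proof (rule integral_mono)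
    fix u
    have "(?p (c + u) - ?p (c' + u)) * ?l u \<le> \<bar>?p (c + u) - ?p (c' + u)\<bar> * \<bar>?l u\<bar>"
      by (metis abs_ge_self abs_mult)
    also have "\<dots> \<le> \<bar>?p (c + u) - ?p (c' + u)\<bar> * (R * N x)" by (rule mult_left_mono[OF l]) simp
    finally show "?p (c + u) * ?l u - ?p (c' + u) * ?l u \<le> R * N x * \<bar>?p (c + u) - ?p (c' + u)\<bar>"
      by (simp only: left_diff_distrib mult.commute[of "R * N x"])
  qed (use int p_int in auto)
  also have "\<dots> = R * N x * (\<integral>u. \<bar>?p (c + u) - ?p (c' + u)\<bar> \<partial>lborel)" by simp
  also have "\<dots> \<le> R * N x * (N (c - c') * M)"
    using noise_density_translation R_nonneg is_norm_nonneg[OF norm] by (intro mult_left_mono) auto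
  also have "c - c' = - (1 / \<alpha>) *\<^sub>R (y - y')" by (simp add: c_def c'_def algebra_simps)
  also have "N \<dots> = N (y - y') / \<alpha>" using alpha by (simp only: is_normD(3)[OF norm]) simp
  finally show ?thesis by (simp add: mult_ac)
qed

lemma smoothed_support_subgradient:
  "smoothed_support K \<eta> \<alpha> y + inner (mean_argmax y) (y' - y) \<le> smoothed_support K \<eta> \<alpha> y'"
proof -
  have "smoothed_support K \<eta> \<alpha> y + inner (mean_argmax y) (y' - y)
      = (\<integral>z. support_fun K (y + \<alpha> *\<^sub>R z) + inner (lmo (y + \<alpha> *\<^sub>R z)) (y' - y) \<partial>noise_law \<eta>)"
    unfolding smoothed_support_def inner_mean_argmax
    using perturbed_support_integrable lmo_integrable by (subst Bochner_Integration.integral_add) auto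
  also have "\<dots> \<le> smoothed_support K \<eta> \<alpha> y'"
    unfolding smoothed_support_def
  proof (rule integral_mono)
    fix z
    have "inner (lmo (y + \<alpha> *\<^sub>R z)) (y' + \<alpha> *\<^sub>R z) \<le> support_fun K (y' + \<alpha> *\<^sub>R z)"
      by (rule inner_le_support_fun[OF lmo_in])
    then show "support_fun K (y + \<alpha> *\<^sub>R z) + inner (lmo (y + \<alpha> *\<^sub>R z)) (y' - y)
        \<le> support_fun K (y' + \<alpha> *\<^sub>R z)"
      by (simp add: support_fun_lmo inner_add_right inner_diff_right)
  qed (use perturbed_support_integrable lmo_integrable in auto)
  finally show ?thesis .
qed

text \<open>
  The Lipschitz bound in terms of the Euclidean norm, in which derivatives and continuity are expressed.
\<close>

lemma mean_argmax_modulus: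
  obtains C where "0 < C"
    "\<And>y y' x. inner (mean_argmax y - mean_argmax y') x \<le> C * norm (y - y') * norm x"
proof -
  define b where "b = R * M / \<alpha>"
  have b: "0 \<le> b" using alpha R_nonneg M(2) by (simp add: b_def)
  obtain C where C: "0 < C" "\<And>x. N x \<le> C * norm x" using is_norm_le_norm[OF norm] by blast
  have "inner (mean_argmax y - mean_argmax y') x \<le> ((b + 1) * C * C) * norm (y - y') * norm x" for y y' x
  proof -
    have "inner (mean_argmax y - mean_argmax y') x \<le> b * (N (y - y') * N x)"
      using mean_argmax_lipschitz[of y y' x] by (simp add: b_def mult.assoc)
    also have "\<dots> \<le> (b + 1) * ((C * norm (y - y')) * (C * norm x))"
      by (intro mult_mono C(2)) (use b C is_norm_nonneg[OF norm] in simp_all)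
    finally show ?thesis by (simp only: mult_ac)
  qed
  moreover have "0 < (b + 1) * C * C" using b C(1) by simp
  ultimately show ?thesis using that by blast
qed

text \<open>
  \<open>mean_argmax\<close> selects a subgradient at every point; as it is Lipschitz, the first order remainder,
  which lies between zero and the increment of the subgradient paired with the displacement, is quadratic.
\<close>

lemma GDERIV_smoothed_support: "GDERIV (smoothed_support K \<eta> \<alpha>) y :> mean_argmax y"
proof -
  let ?S = "smoothed_support K \<eta> \<alpha>"
  define r where "r w = ?S w - ?S y - inner (w - y) (mean_argmax y)" for w
  obtain C where C: "0 < C"
    "\<And>y y' x. inner (mean_argmax y - mean_argmax y') x \<le> C * norm (y - y') * norm x"
    using mean_argmax_modulus by blast
  have r0: "0 \<le> r w" for w
    using smoothed_support_subgradient[of y w] by (simp add: r_def inner_commute)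
  have r1: "r w \<le> C * norm (w - y) * norm (w - y)" for w
  proof -
    have "r w \<le> inner (mean_argmax w - mean_argmax y) (w - y)"
      using smoothed_support_subgradient[of w y]
      by (simp add: r_def inner_diff_left inner_diff_right inner_commute)
    then show ?thesis using C(2)[of w y "w - y"] by simp
  qed
  have bound: "norm (r w) / norm (w - y) \<le> C * norm (w - y)" for w
  proof (cases "w = y")
    case False
    then show ?thesis using r0[of w] r1[of w] by (simp add: pos_divide_le_eq)
  qed simp
  have "((\<lambda>w. C * norm (w - y)) \<longlongrightarrow> C * norm (y - y)) (at y)" by (intro tendsto_intros)
  then have lim: "((\<lambda>w. C * norm (w - y)) \<longlongrightarrow> 0) (at y)" by simp
  have "((\<lambda>w. norm (r w) / norm (w - y)) \<longlongrightarrow> 0) (at y)"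
    by (rule real_tendsto_sandwich[OF always_eventually always_eventually tendsto_const lim])
      (use bound in simp_all)
  then show ?thesis
    unfolding gderiv_def has_derivative_iff_norm r_def by (simp add: bounded_linear_inner_left)
qed

abbreviation (input) dual_smoothing :: "'v \<Rightarrow> real" where
  "dual_smoothing \<equiv> \<lambda>w. smoothed_support K \<eta> \<alpha> (- w)"

lemma GDERIV_dual_smoothing: "GDERIV dual_smoothing v :> - mean_argmax (- v)"
proof -
  have "((\<lambda>w. - w) has_derivative (\<lambda>u. - u)) (at v)" by (auto intro!: derivative_eq_intros)
  from has_derivative_compose[OF this GDERIV_smoothed_support[unfolded gderiv_def]]
  show ?thesis by (simp add: gderiv_def)
qed

lemma grad_dual_smoothing: "grad dual_smoothing v = - mean_argmax (- v)"
  by (rule grad_eqI[OF GDERIV_dual_smoothing])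

lemma dual_smoothing_subgradient:
  "dual_smoothing v + inner (grad dual_smoothing v) (y - v) \<le> dual_smoothing y"
  using smoothed_support_subgradient[of "- v" "- y"]
  by (simp add: grad_dual_smoothing inner_diff_right)

lemma dual_smoothing_upper_bound:
  "dual_smoothing y \<le> dual_smoothing v + inner (grad dual_smoothing v) (y - v)
    + (R * M / \<alpha>) / 2 * (N (y - v))\<^sup>2"
proof (rule smooth_upper_bound[OF _ norm])
  show "GDERIV dual_smoothing x :> grad dual_smoothing x" for x
    using GDERIV_dual_smoothing by (simp add: grad_dual_smoothing)
  fix x y
  show "inner (grad dual_smoothing y - grad dual_smoothing x) (y - x) \<le> R * M / \<alpha> * (N (y - x))\<^sup>2"
    using mean_argmax_lipschitz[of "- x" "- y" "y - x"]
    by (simp add: grad_dual_smoothing power2_eq_square mult_ac inner_diff_left)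
qed

text \<open>
  The left-hand side is the value at the origin of the tangent of \<open>G\<close> at \<open>v\<close>.  It equals
  \<open>\<alpha> E \<langle>u, \<Delta>\<rangle>\<close> for the perturbed maximizer \<open>u\<close>, an element of \<open>K\<close>.
\<close>

lemma dual_smoothing_tangent_at_0:
  "dual_smoothing v - inner (grad dual_smoothing v) v \<le> \<alpha> * smoothed_support K \<eta> 1 0"
proof -
  have "dual_smoothing v - inner (grad dual_smoothing v) v
      = (\<integral>z. support_fun K (- v + \<alpha> *\<^sub>R z) + inner (lmo (- v + \<alpha> *\<^sub>R z)) v \<partial>noise_law \<eta>)"
    unfolding grad_dual_smoothing inner_minus_left inner_mean_argmax
    unfolding smoothed_support_def
    using perturbed_support_integrable[of "- v"] lmo_integrable[of "- v"]
    by (subst Bochner_Integration.integral_add) auto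
  also have "\<dots> \<le> (\<integral>z. \<alpha> * support_fun K z \<partial>noise_law \<eta>)"
  proof (rule integral_mono)
    fix z
    have "support_fun K (- v + \<alpha> *\<^sub>R z) + inner (lmo (- v + \<alpha> *\<^sub>R z)) v
        = \<alpha> * inner (lmo (- v + \<alpha> *\<^sub>R z)) z"
      by (simp add: support_fun_lmo inner_add_right inner_diff_right)
    also have "\<dots> \<le> \<alpha> * support_fun K z" using alpha inner_le_support_fun[OF lmo_in] by simp
    finally show "support_fun K (- v + \<alpha> *\<^sub>R z) + inner (lmo (- v + \<alpha> *\<^sub>R z)) v \<le> \<alpha> * support_fun K z" .
  qed (use perturbed_support_integrable[of "- v"] lmo_integrable[of "- v"] support_integrable in auto)
  also have "\<dots> = \<alpha> * smoothed_support K \<eta> 1 0" by (simp add: smoothed_support_def)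
  finally show ?thesis .
qed

lemma mean_argmax_continuous: "continuous_on S mean_argmax"
proof -
  obtain C where C: "0 < C"
    "\<And>y y' x. inner (mean_argmax y - mean_argmax y') x \<le> C * norm (y - y') * norm x"
    using mean_argmax_modulus by blast
  have "C-lipschitz_on S mean_argmax"
  proof (rule lipschitz_onI)
    fix y y'
    let ?d = "mean_argmax y - mean_argmax y'"
    have "norm ?d * norm ?d \<le> C * norm (y - y') * norm ?d"
      using C(2)[of y y' ?d] by (simp flip: power2_eq_square add: power2_norm_eq_inner)
    then have "norm ?d \<le> C * norm (y - y')"
      using C(1) by (cases "?d = 0") (simp_all add: mult_le_cancel_right)
    then show "dist (mean_argmax y) (mean_argmax y') \<le> C * dist y y'" by (simp add: dist_norm)
  qed (use C in simp)
  then show ?thesis by (rule lipschitz_on_continuous_on)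
qed

end

section \<open>One step of the accelerated method\<close>

text \<open>
  Each part of the potential is compared separately: \<open>f\<^sup>*\<close> by convexity and its known value at the
  gradient \<open>w' = \<nabla>f x'\<close>, \<open>G\<close> by its lower and upper models at \<open>v\<close>, and \<open>f\<close> by co-coercivity.  The inner
  products combine through the dual averaging update of \<open>x'\<close>.  What remains is quadratic in \<open>N (w' - w)\<close>:
  the smoothness error of \<open>G\<close> and the part of the noise absorbed by Young's inequality with weight \<open>s\<close> add
  up to exactly the gain from co-coercivity.  The bound \<open>c\<close> stands for \<open>f\<^sup>* y\<close>, which is a priori an
  extended real.
\<close>

lemma potential_step:
  fixes f G :: "'v::euclidean_space \<Rightarrow> real" and x x' y y' v g \<gamma> :: 'v
  assumes norm: "is_norm N" and f: "convex_on UNIV f" "smooth_dual N (1 / \<mu>) f"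
    and pos: "0 < \<mu>" "0 < \<beta>" "0 \<le> A" "A < A'" "0 < s"
    and root: "(A + \<beta>) * \<mu> * A' = \<beta> * (A' - A)\<^sup>2 + s * (A' - A) * A'"
    and G_lower: "\<And>u. G v + inner \<gamma> (u - v) \<le> G u"
    and G_upper: "\<And>u. G u \<le> G v + inner \<gamma> (u - v) + \<beta> / 2 * (N (u - v))\<^sup>2"
    and tau: "\<tau> = 1 - A / A'"
    and v: "v = (1 - \<tau>) *\<^sub>R y + \<tau> *\<^sub>R grad f x"
    and y': "y' = (1 - \<tau>) *\<^sub>R y + \<tau> *\<^sub>R grad f x'"
    and x': "(A' + \<beta>) *\<^sub>R x' = (A + \<beta>) *\<^sub>R x - (A' - A) *\<^sub>R g"
    and c: "conjugate f y \<le> ereal c"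
  obtains c' where "conjugate f y' \<le> ereal c'"
    "A' * (G y' + c') + (A' + \<beta>) * f x'
      \<le> A * (G y + c) + (A + \<beta>) * f x
        + (A' - A) * (G v - inner \<gamma> v - inner (g - \<gamma>) (grad f x) + (dual_norm N (g - \<gamma>))\<^sup>2 / (2 * s))"
proof
  define w w' a n where "w = grad f x" and "w' = grad f x'" and "a = A' - A" and "n = N (w' - w)"
  define \<xi> where "\<xi> = g - \<gamma>"
  define c' where "c' = (1 - \<tau>) * c + \<tau> * (inner x' w' - f x')"
  have A': "A' = A + a" "0 < a" "0 < A'" using pos by (auto simp: a_def)
  have t: "0 \<le> \<tau>" "\<tau> \<le> 1" "A' * \<tau> = a" "A' * (1 - \<tau>) = A"
    using pos by (auto simp: tau a_def field_simps)
  note deriv = smooth_dual_GDERIV[OF f(2)]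
  show "conjugate f y' \<le> ereal c'"
    unfolding y' c'_def w'_def
    by (rule conjugate_convex_bound[OF c _ t(1,2)]) (simp add: conjugate_gradient[OF f(1) deriv])
  have c'_eq: "A' * c' = A * c + a * (inner x' w' - f x')"
    by (simp only: c'_def distrib_left mult.assoc[symmetric] t)
  have N_scaled: "(N (\<tau> *\<^sub>R (w' - w)))\<^sup>2 = \<tau> * \<tau> * n\<^sup>2"
    by (simp add: is_normD(3)[OF norm] n_def power_mult_distrib power2_eq_square)
  have "y' - v = \<tau> *\<^sub>R (w' - w)" by (simp add: y' v w_def w'_def algebra_simps)
  then have "A' * G y' \<le> A' * (G v + inner \<gamma> (\<tau> *\<^sub>R (w' - w)) + \<beta> / 2 * (N (\<tau> *\<^sub>R (w' - w)))\<^sup>2)"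
    using G_upper[of y'] A' by (intro mult_left_mono) auto
  also have "\<dots> = A' * G v + A' * \<tau> * inner \<gamma> (w' - w) + \<beta> / 2 * (A' * \<tau> * \<tau>) * n\<^sup>2"
    by (simp only: inner_scaleR_right N_scaled distrib_left mult_ac)
  also have "A' * \<tau> * \<tau> = a\<^sup>2 / A'"
    using t(3) A'(3) by (simp add: power2_eq_square field_simps)
  finally have Gy': "A' * G y' \<le> A' * G v + a * inner \<gamma> (w' - w) + \<beta> / 2 * (a\<^sup>2 / A') * n\<^sup>2"
    by (simp only: t(3))
  have "A *\<^sub>R (y - v) = a *\<^sub>R (v - w)"
  proof -
    have "A' *\<^sub>R v = A *\<^sub>R y + a *\<^sub>R w" by (simp only: v scaleR_add_right scaleR_scaleR t w_def)
    then show ?thesis by (simp add: A'(1) algebra_simps)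
  qed
  then have "A * (G v + inner \<gamma> (y - v)) = A * G v + a * inner \<gamma> (v - w)"
    by (metis distrib_left inner_scaleR_right)
  then have Gy: "A * G v + a * inner \<gamma> (v - w) \<le> A * G y"
    using mult_left_mono[OF G_lower[of y] pos(3)] by simp
  have "f x' + inner w' (x - x') + 1 / (2 * (1 / \<mu>)) * (N (w - w'))\<^sup>2 \<le> f x"
    unfolding w_def w'_def using pos by (intro smooth_convex_cocoercive[OF norm f]) simp
  then have "(A + \<beta>) * (f x' + inner w' (x - x') + \<mu> / 2 * n\<^sup>2) \<le> (A + \<beta>) * f x"
    using pos by (intro mult_left_mono) (simp_all add: n_def is_norm_commute[OF norm, of w])
  then have co: "(A + \<beta>) * f x' + (A + \<beta>) * inner w' (x - x') + (A + \<beta>) * \<mu> / 2 * n\<^sup>2 \<le> (A + \<beta>) * f x"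
    by (simp add: distrib_left mult.assoc)
  have "inner w' ((A' + \<beta>) *\<^sub>R x') = inner w' ((A + \<beta>) *\<^sub>R x - a *\<^sub>R g)"
    by (simp only: x' a_def)
  then have lin: "a * inner x' w' - (A + \<beta>) * inner w' (x - x') = - (a * inner w' g)"
    by (simp add: A'(1) inner_diff_right inner_commute algebra_simps)
  \<comment> \<open>The weight \<open>s\<close> is the one that the recursion for the cumulative weights contains, here used in the inequality of Young.\<close>
  have noise: "- (a * inner \<xi> (w' - w)) \<le> a * ((dual_norm N \<xi>)\<^sup>2 / (2 * s)) + a * s / 2 * n\<^sup>2"
  proof -
    have "- inner \<xi> (w' - w) \<le> dual_norm N \<xi> * n"
      using abs_inner_le_dual_norm[OF norm, of \<xi> "w' - w"] by (simp add: n_def)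
    also have "\<dots> \<le> (dual_norm N \<xi>)\<^sup>2 / (2 * s) + s / 2 * n\<^sup>2"
    proof -
      have "0 \<le> (dual_norm N \<xi> - s * n)\<^sup>2 / (2 * s)" using pos by simp
      also have "\<dots> = (dual_norm N \<xi>)\<^sup>2 / (2 * s) + s / 2 * n\<^sup>2 - dual_norm N \<xi> * n"
        using pos by (simp add: power2_eq_square field_simps)
      finally show ?thesis by simp
    qed
    finally have "a * - inner \<xi> (w' - w) \<le> a * ((dual_norm N \<xi>)\<^sup>2 / (2 * s) + s / 2 * n\<^sup>2)"
      using A'(2) by (intro mult_left_mono) auto
    then show ?thesis by (simp add: distrib_left mult.assoc)
  qed
  have "\<beta> / 2 * (a\<^sup>2 / A') + a * s / 2 = (A + \<beta>) * \<mu> / 2"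
    using root A'(3) unfolding a_def[symmetric] by (simp add: field_simps)
  then have coef: "\<beta> / 2 * (a\<^sup>2 / A') * n\<^sup>2 + a * s / 2 * n\<^sup>2 = (A + \<beta>) * \<mu> / 2 * n\<^sup>2"
    by (simp only: distrib_right[symmetric])
  have "A' * (G y' + c') + (A' + \<beta>) * f x' = A' * G y' + A' * c' + (A + \<beta>) * f x' + a * f x'"
    by (simp add: A'(1) algebra_simps)
  moreover have "A * (G y + c) = A * G y + A * c" by (rule distrib_left)
  moreover have "a * (inner x' w' - f x') = a * inner x' w' - a * f x'" by (rule right_diff_distrib)
  moreover have "A' * G v = A * G v + a * G v" by (simp add: A'(1) distrib_right)
  moreover have "a * inner \<gamma> (w' - w) = a * inner \<gamma> w' - a * inner \<gamma> w"
    "a * inner \<gamma> (v - w) = a * inner \<gamma> v - a * inner \<gamma> w"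
    "a * inner \<xi> (w' - w) = a * inner \<xi> w' - a * inner \<xi> w"
    by (simp_all only: inner_diff_right right_diff_distrib)
  moreover have "a * inner \<xi> w' = a * inner w' g - a * inner \<gamma> w'"
    by (simp add: \<xi>_def inner_diff_left right_diff_distrib inner_commute[of g])
  moreover have "a * (G v - inner \<gamma> v - inner \<xi> w + (dual_norm N \<xi>)\<^sup>2 / (2 * s))
      = a * G v - a * inner \<gamma> v - a * inner \<xi> w + a * ((dual_norm N \<xi>)\<^sup>2 / (2 * s))"
    by (simp only: distrib_left right_diff_distrib)
  ultimately have "A' * (G y' + c') + (A' + \<beta>) * f x' \<le> A * (G y + c) + (A + \<beta>) * f x
      + a * (G v - inner \<gamma> v - inner \<xi> w + (dual_norm N \<xi>)\<^sup>2 / (2 * s))"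
    using c'_eq Gy' Gy co lin noise coef by linarith
  then show "A' * (G y' + c') + (A' + \<beta>) * f x' \<le> A * (G y + c) + (A + \<beta>) * f x
      + (A' - A) * (G v - inner \<gamma> v - inner (g - \<gamma>) (grad f x) + (dual_norm N (g - \<gamma>))\<^sup>2 / (2 * s))"
    by (simp only: a_def \<xi>_def w_def)
qed

section \<open>Independence of the past\<close>

text \<open>
  Independence passes to \<open>Z\<close>, which only depends on \<open>X\<close>, and to a function of \<open>Y\<close>.  It is expressed by
  the joint distribution because \<open>Z\<close> and \<open>W \<circ> Y\<close> may take values in different types.
\<close>

lemma (in prob_space) indep_var_joint_distr:
  assumes ind: "indep_var S X T Y" and Z: "Z \<in> measurable (vimage_algebra (space M) X S) U"
    and W: "W \<in> measurable T V"
  shows "distr M U Z \<Otimes>\<^sub>M distr M V (\<lambda>\<omega>. W (Y \<omega>))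
    = distr M (U \<Otimes>\<^sub>M V) (\<lambda>\<omega>. (Z \<omega>, W (Y \<omega>)))"
proof -
  let ?\<sigma> = "\<lambda>X S. sigma_sets (space M) {X -` A \<inter> space M |A. A \<in> sets S}"
  have X: "random_variable S X" and Y [measurable]: "random_variable T Y"
    and XY: "indep_set (?\<sigma> X S) (?\<sigma> Y T)"
    using ind by (auto simp: indep_var_eq)
  note W [measurable]
  have sX: "X \<in> space M \<rightarrow> space S" using X by (rule measurable_space[THEN funcsetI])
  have sets_eq: "sets (vimage_algebra (space M) X S) = ?\<sigma> X S" by (rule sets_vimage_algebra)
  have in_X: "Z -` A \<inter> space M \<in> ?\<sigma> X S" if "A \<in> sets U" for A
    using measurable_sets[OF Z that] by (simp add: sets_eq)
  have Z' [measurable]: "random_variable U Z"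
  proof (rule measurableI)
    show "Z w \<in> space U" if "w \<in> space M" for w using measurable_space[OF Z] that by simp
    show "Z -` A \<inter> space M \<in> events" if "A \<in> sets U" for A
      using in_X[OF that] XY unfolding indep_sets2_eq by blast
  qed
  interpret Z: prob_space "distr M U Z" by (rule prob_space_distr) measurable
  interpret W: prob_space "distr M V (\<lambda>\<omega>. W (Y \<omega>))" by (rule prob_space_distr) measurable
  show ?thesis
  proof (rule pair_measure_eqI)
    fix A B assume "A \<in> sets (distr M U Z)" "B \<in> sets (distr M V (\<lambda>\<omega>. W (Y \<omega>)))"
    then have AB [measurable]: "A \<in> sets U" "B \<in> sets V" by simp_all
    let ?a = "Z -` A \<inter> space M" and ?b = "(\<lambda>\<omega>. W (Y \<omega>)) -` B \<inter> space M"
    have "?b = Y -` (W -` B \<inter> space T) \<inter> space M" using measurable_space[OF Y] by auto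
    then have "?b \<in> ?\<sigma> Y T" using measurable_sets[OF W AB(2)] by blast
    then have "prob (?a \<inter> ?b) = prob ?a * prob ?b"
      using XY in_X[OF AB(1)] unfolding indep_sets2_eq by blast
    moreover have "(\<lambda>\<omega>. (Z \<omega>, W (Y \<omega>))) -` (A \<times> B) \<inter> space M = ?a \<inter> ?b" by auto
    ultimately show "emeasure (distr M U Z) A * emeasure (distr M V (\<lambda>\<omega>. W (Y \<omega>))) B
        = emeasure (distr M (U \<Otimes>\<^sub>M V) (\<lambda>\<omega>. (Z \<omega>, W (Y \<omega>)))) (A \<times> B)"
      by (simp add: emeasure_distr emeasure_eq_measure ennreal_mult)
  qed (simp_all add: Z.sigma_finite_measure_axioms W.sigma_finite_measure_axioms cong: sets_pair_measure_cong)
qed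

lemma past_algebra_alt:
  "past_algebra P \<Delta> m k = vimage_algebra (space P)
     (\<lambda>\<omega>. restrict (\<lambda>p. (case p of (j, i) \<Rightarrow> \<Delta> j i) \<omega>) ({..<k} \<times> {..<m}))
     (PiM ({..<k} \<times> {..<m}) (\<lambda>_. borel))"
  unfolding past_algebra_def by (intro arg_cong2[where f = "\<lambda>g. vimage_algebra (space P) g"] ext)
    (auto simp: restrict_def)

lemma space_past_algebra [simp]: "space (past_algebra P \<Delta> m k) = space P"
  by (simp add: past_algebra_def)

lemma past_algebra_measurable:
  assumes "j < k" "i < m"
  shows "\<Delta> j i \<in> borel_measurable (past_algebra P \<Delta> m k)"
proof -
  let ?I = "{..<k} \<times> {..<m}"
  let ?X = "\<lambda>\<omega>. restrict (\<lambda>p. (case p of (j, i) \<Rightarrow> \<Delta> j i) \<omega>) ?I"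
  have "?X \<in> measurable (past_algebra P \<Delta> m k) (PiM ?I (\<lambda>_. borel))"
    unfolding past_algebra_alt by (rule measurable_vimage_algebra1) (auto simp: space_PiM)
  from measurable_compose[OF this measurable_component_singleton[of "(j, i)"]] assms
  show ?thesis by simp
qed

section \<open>A run of the algorithm\<close>

text \<open>
  Bounds on the variance of the samples, and on the support function by its smoothing, are left to the
  lemmas about expectations and about the gap, where they are hypotheses.
\<close>

locale frank_wolfe_run = perturbed_argmax N K \<eta> \<alpha> R M lmo + P: prob_space P
  for N :: "'v::euclidean_space \<Rightarrow> real" and K :: "'v set" and \<eta> :: "'v \<Rightarrow> real"
    and \<alpha> R M :: real and lmo :: "'v \<Rightarrow> 'v" and P :: "'b measure" +
  fixes f :: "'v \<Rightarrow> real" and L :: real and m :: nat and x0 :: 'v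
    and \<Delta> :: "nat \<Rightarrow> nat \<Rightarrow> 'b \<Rightarrow> 'v"
    and x y d v :: "nat \<Rightarrow> 'b \<Rightarrow> 'v" and g :: "nat \<Rightarrow> nat \<Rightarrow> 'b \<Rightarrow> 'v"
  assumes K_convex: "convex K"
    and f: "convex_on UNIV f" "L > 0" "smooth_dual N L f"
    and x0: "x0 \<in> K"
    and RM_pos: "R > 0" "M > 0"
    and m: "m \<ge> 1"
    and Delta_law: "\<And>k i. i < m \<Longrightarrow> distributed P lborel (\<Delta> k i) (\<lambda>z. ennreal (noise_density \<eta> z))"
    and Delta_indep: "prob_space.indep_vars P (\<lambda>_. borel) (\<lambda>(k, i). \<Delta> k i) (UNIV \<times> {..<m})"
    and algorithm: "\<And>\<omega>. \<omega> \<in> space P \<Longrightarrow>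
      parallel_frank_wolfe f lmo \<alpha> (R * M / \<alpha>) (1 / L) m x0 (\<lambda>k i. \<Delta> k i \<omega>)
        (\<lambda>k. x k \<omega>) (\<lambda>k. y k \<omega>) (\<lambda>k. d k \<omega>) (\<lambda>k. v k \<omega>) (\<lambda>k i. g k i \<omega>)"
begin

definition \<beta> :: real where "\<beta> = R * M / \<alpha>"
definition \<mu> :: real where "\<mu> = 1 / L"
abbreviation "A \<equiv> A_seq \<beta> \<mu>"
abbreviation "s \<equiv> sqrt (\<mu> * \<beta>)"

definition step :: "nat \<Rightarrow> real" where "step k = A (Suc k) - A k"

definition g_mean :: "nat \<Rightarrow> 'b \<Rightarrow> 'v" where
  "g_mean k \<omega> = (1 / real m) *\<^sub>R (\<Sum>i<m. g k i \<omega>)"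

definition noise_error :: "nat \<Rightarrow> 'b \<Rightarrow> 'v" where
  "noise_error k \<omega> = g_mean k \<omega> - grad dual_smoothing (v k \<omega>)"

definition gap :: "nat \<Rightarrow> 'b \<Rightarrow> real" where
  "gap k \<omega> = f (x k \<omega>) - real_of_ereal (dual_objective K f (y k \<omega>))"

lemma beta_pos: "0 < \<beta>" and mu_pos: "0 < \<mu>" and s_pos: "0 < s"
  using RM_pos alpha f(2) by (auto simp: \<beta>_def \<mu>_def)

lemma A_nonneg: "0 \<le> A k" and A_less: "A k < A (Suc k)"
  using A_seq_nonneg[OF beta_pos mu_pos] A_seq_strict_mono[OF beta_pos mu_pos] by auto

lemma step_pos: "0 < step k"
  using A_less by (simp add: step_def)

lemma sum_step: "(\<Sum>i<k. step i) = A k"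
  unfolding step_def using sum_lessThan_telescope[of A k] by simp

lemma run_0:
  assumes "\<omega> \<in> space P"
  shows "x 0 \<omega> = x0" "y 0 \<omega> = grad f x0" "d 0 \<omega> = 0"
  using algorithm[OF assms, folded \<beta>_def \<mu>_def] unfolding parallel_frank_wolfe_def by auto

lemma run_Suc:
  assumes "\<omega> \<in> space P"
  defines "\<tau> \<equiv> tau_seq \<beta> \<mu>"
  shows "v k \<omega> = (1 - \<tau> k) *\<^sub>R y k \<omega> + \<tau> k *\<^sub>R grad f (x k \<omega>)"
    "\<And>i. i < m \<Longrightarrow> g k i \<omega> = - lmo (- v k \<omega> + \<alpha> *\<^sub>R \<Delta> k i \<omega>)"
    "d (Suc k) \<omega> = d k \<omega> + step k *\<^sub>R g_mean k \<omega>"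
    "x (Suc k) \<omega> = (\<beta> / (A (Suc k) + \<beta>)) *\<^sub>R x0 - (1 / (A (Suc k) + \<beta>)) *\<^sub>R d (Suc k) \<omega>"
    "y (Suc k) \<omega> = (1 - \<tau> k) *\<^sub>R y k \<omega> + \<tau> k *\<^sub>R grad f (x (Suc k) \<omega>)"
proof -
  have "let A0 = A k; A' = A (Suc k); \<tau> = tau_seq \<beta> \<mu> k in
        v k \<omega> = (1 - \<tau>) *\<^sub>R y k \<omega> + \<tau> *\<^sub>R grad f (x k \<omega>) \<and>
        (\<forall>i<m. g k i \<omega> = - lmo (- v k \<omega> + \<alpha> *\<^sub>R \<Delta> k i \<omega>)) \<and>
        d (Suc k) \<omega> = d k \<omega> + (A' - A0) *\<^sub>R ((1 / real m) *\<^sub>R (\<Sum>i<m. g k i \<omega>)) \<and>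
        x (Suc k) \<omega> = (\<beta> / (A' + \<beta>)) *\<^sub>R x0 - (1 / (A' + \<beta>)) *\<^sub>R d (Suc k) \<omega> \<and>
        y (Suc k) \<omega> = (1 - \<tau>) *\<^sub>R y k \<omega> + \<tau> *\<^sub>R grad f (x (Suc k) \<omega>)"
    using algorithm[OF assms(1), folded \<beta>_def \<mu>_def] unfolding parallel_frank_wolfe_def by blast
  note this[unfolded Let_def]
  then show "v k \<omega> = (1 - \<tau> k) *\<^sub>R y k \<omega> + \<tau> k *\<^sub>R grad f (x k \<omega>)"
    "\<And>i. i < m \<Longrightarrow> g k i \<omega> = - lmo (- v k \<omega> + \<alpha> *\<^sub>R \<Delta> k i \<omega>)"
    "d (Suc k) \<omega> = d k \<omega> + step k *\<^sub>R g_mean k \<omega>"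
    "x (Suc k) \<omega> = (\<beta> / (A (Suc k) + \<beta>)) *\<^sub>R x0 - (1 / (A (Suc k) + \<beta>)) *\<^sub>R d (Suc k) \<omega>"
    "y (Suc k) \<omega> = (1 - \<tau> k) *\<^sub>R y k \<omega> + \<tau> k *\<^sub>R grad f (x (Suc k) \<omega>)"
    unfolding \<tau>_def step_def g_mean_def by blast+
qed

text \<open>
  The iterate \<open>x\<^sub>k\<close> is a function of the accumulated samples alone.
\<close>

lemma dual_averaging:
  assumes "\<omega> \<in> space P"
  shows "(A k + \<beta>) *\<^sub>R x k \<omega> = \<beta> *\<^sub>R x0 - d k \<omega>"
proof (cases k)
  case 0 then show ?thesis by (simp add: run_0[OF assms])
next
  case (Suc j)
  have "A (Suc j) + \<beta> \<noteq> 0" using A_nonneg[of "Suc j"] beta_pos by simp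
  then show ?thesis
    unfolding Suc run_Suc(4)[OF assms] scaleR_diff_right scaleR_scaleR times_divide_eq_right
    by simp
qed

lemma x_step:
  assumes "\<omega> \<in> space P"
  shows "(A (Suc k) + \<beta>) *\<^sub>R x (Suc k) \<omega> = (A k + \<beta>) *\<^sub>R x k \<omega> - step k *\<^sub>R g_mean k \<omega>"
  unfolding dual_averaging[OF assms] run_Suc(3)[OF assms] by simp

lemma minus_g_mean_in:
  assumes "\<omega> \<in> space P" shows "- g_mean k \<omega> \<in> K"
proof -
  have "(\<Sum>i<m. (1 / real m) *\<^sub>R lmo (- v k \<omega> + \<alpha> *\<^sub>R \<Delta> k i \<omega>)) \<in> K"
    using m lmo_in by (intro convex_sum K_convex) auto
  also have "(\<Sum>i<m. (1 / real m) *\<^sub>R lmo (- v k \<omega> + \<alpha> *\<^sub>R \<Delta> k i \<omega>)) = - g_mean k \<omega>"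
    using run_Suc(2)[OF assms, of _ k] by (simp add: g_mean_def scaleR_sum_right sum_negf)
  finally show ?thesis .
qed

lemma x_in:
  assumes "\<omega> \<in> space P" shows "x k \<omega> \<in> K"
proof (induction k)
  case 0 then show ?case by (simp add: run_0[OF assms] x0)
next
  case (Suc k)
  \<comment> \<open>The weight of the new samples in the convex combination giving the next iterate.\<close>
  define r where "r = step k / (A (Suc k) + \<beta>)"
  have den: "0 < A (Suc k) + \<beta>" using A_nonneg[of "Suc k"] beta_pos by simp
  have scaled: "(A (Suc k) + \<beta>) * r = step k" using den by (simp add: r_def)
  have "(A (Suc k) + \<beta>) * (1 - r) = A k + \<beta>"
    unfolding right_diff_distrib scaled by (simp add: step_def)
  moreover have "0 \<le> r" "r \<le> 1"
    using den step_pos[of k] A_nonneg[of k] beta_pos by (auto simp: r_def step_def)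
  ultimately have r: "0 \<le> r" "r \<le> 1" "(A (Suc k) + \<beta>) * r = step k"
    "(A (Suc k) + \<beta>) * (1 - r) = A k + \<beta>" using scaled by auto
  have "(A (Suc k) + \<beta>) *\<^sub>R x (Suc k) \<omega> = (A (Suc k) + \<beta>) *\<^sub>R ((1 - r) *\<^sub>R x k \<omega> + r *\<^sub>R (- g_mean k \<omega>))"
    unfolding x_step[OF assms] scaleR_add_right scaleR_scaleR r by simp
  then have "x (Suc k) \<omega> = (1 - r) *\<^sub>R x k \<omega> + r *\<^sub>R (- g_mean k \<omega>)"
    using den by (simp del: scaleR_minus_right)
  also have "\<dots> \<in> K"
    using convexD_alt[OF K_convex Suc minus_g_mean_in[OF assms] r(1,2)] .
  finally show ?case .
qed

text \<open>A bound for the growth of the potential in one iteration, per unit of step size.\<close>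

definition excess :: "nat \<Rightarrow> 'b \<Rightarrow> real" where
  "excess k \<omega> = \<alpha> * smoothed_support K \<eta> 1 0 - inner (noise_error k \<omega>) (grad f (x k \<omega>))
     + (dual_norm N (noise_error k \<omega>))\<^sup>2 / (2 * s)"

text \<open>
  The number \<open>c\<close> is an upper bound for \<open>f\<^sup>* y\<^sub>k\<close> obtained along the induction from the values of \<open>f\<^sup>*\<close> at
  gradients; in particular it certifies that \<open>f\<^sup>* y\<^sub>k\<close> is finite.
\<close>

lemma potential_bound:
  assumes "\<omega> \<in> space P"
  obtains c where "conjugate f (y k \<omega>) \<le> ereal c"
    "A k * (dual_smoothing (y k \<omega>) + c) + (A k + \<beta>) * f (x k \<omega>)
      \<le> \<beta> * f x0 + (\<Sum>i<k. step i * excess i \<omega>)"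
proof -
  have "\<exists>c. conjugate f (y k \<omega>) \<le> ereal c \<and>
      A k * (dual_smoothing (y k \<omega>) + c) + (A k + \<beta>) * f (x k \<omega>)
        \<le> \<beta> * f x0 + (\<Sum>i<k. step i * excess i \<omega>)"
  proof (induction k)
    case 0
    show ?case
      using conjugate_gradient[OF f(1) smooth_dual_GDERIV[OF f(3)], of x0]
      by (intro exI[of _ "inner x0 (grad f x0) - f x0"]) (simp add: run_0[OF assms])
  next
    case (Suc k)
    then obtain c where c: "conjugate f (y k \<omega>) \<le> ereal c"
      and le: "A k * (dual_smoothing (y k \<omega>) + c) + (A k + \<beta>) * f (x k \<omega>)
        \<le> \<beta> * f x0 + (\<Sum>i<k. step i * excess i \<omega>)" by blast
    let ?G = dual_smoothing and ?\<gamma> = "grad dual_smoothing (v k \<omega>)"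
    have f': "smooth_dual N (1 / \<mu>) f" using f(3) by (simp add: \<mu>_def)
    obtain c' where c': "conjugate f (y (Suc k) \<omega>) \<le> ereal c'"
      and step: "A (Suc k) * (?G (y (Suc k) \<omega>) + c') + (A (Suc k) + \<beta>) * f (x (Suc k) \<omega>)
      \<le> A k * (?G (y k \<omega>) + c) + (A k + \<beta>) * f (x k \<omega>)
        + (A (Suc k) - A k) * (?G (v k \<omega>) - inner ?\<gamma> (v k \<omega>)
            - inner (g_mean k \<omega> - ?\<gamma>) (grad f (x k \<omega>)) + (dual_norm N (g_mean k \<omega> - ?\<gamma>))\<^sup>2 / (2 * s))"
      by (rule potential_step[OF norm f(1) f' mu_pos beta_pos A_nonneg A_less s_pos
          A_seq_Suc_root(1)[OF beta_pos mu_pos A_nonneg] dual_smoothing_subgradient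
          dual_smoothing_upper_bound[folded \<beta>_def] tau_seq_def run_Suc(1)[OF assms] run_Suc(5)[OF assms]
          x_step[OF assms, unfolded step_def] c])
    have "?G (v k \<omega>) - inner ?\<gamma> (v k \<omega>)
            - inner (g_mean k \<omega> - ?\<gamma>) (grad f (x k \<omega>)) + (dual_norm N (g_mean k \<omega> - ?\<gamma>))\<^sup>2 / (2 * s)
        \<le> excess k \<omega>"
      using dual_smoothing_tangent_at_0[of "v k \<omega>"] by (simp add: excess_def noise_error_def)
    from mult_left_mono[OF this less_imp_le[OF step_pos[of k]]]
    have "A (Suc k) * (?G (y (Suc k) \<omega>) + c') + (A (Suc k) + \<beta>) * f (x (Suc k) \<omega>)
        \<le> \<beta> * f x0 + (\<Sum>i<Suc k. step i * excess i \<omega>)"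
      using step le unfolding step_def by simp
    with c' show ?case by blast
  qed
  with that show ?thesis by blast
qed

lemma gap_eq:
  assumes "\<omega> \<in> space P"
  shows "\<bar>dual_objective K f (y k \<omega>)\<bar> \<noteq> \<infinity>"
    and "gap k \<omega> = f (x k \<omega>) + support_fun K (- y k \<omega>) + real_of_ereal (conjugate f (y k \<omega>))"
    and "conjugate f (y k \<omega>) = ereal (real_of_ereal (conjugate f (y k \<omega>)))"
proof -
  obtain c where "conjugate f (y k \<omega>) \<le> ereal c" using potential_bound[OF assms] by metis
  then have "\<bar>conjugate f (y k \<omega>)\<bar> \<noteq> \<infinity>" using conjugate_ge[of x0 "y k \<omega>" f] by auto
  then obtain r where r: "conjugate f (y k \<omega>) = ereal r" by auto
  show "\<bar>dual_objective K f (y k \<omega>)\<bar> \<noteq> \<infinity>"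
    and "gap k \<omega> = f (x k \<omega>) + support_fun K (- y k \<omega>) + real_of_ereal (conjugate f (y k \<omega>))"
    and "conjugate f (y k \<omega>) = ereal (real_of_ereal (conjugate f (y k \<omega>)))"
    by (simp_all add: gap_def dual_objective_def r)
qed

text \<open>
  Weak duality: feasibility of \<open>x\<^sub>k\<close> bounds the support function below, and the Fenchel--Young
  inequality bounds the conjugate.
\<close>

lemma gap_nonneg:
  assumes "\<omega> \<in> space P" shows "0 \<le> gap k \<omega>"
proof -
  have "inner (x k \<omega>) (- y k \<omega>) \<le> support_fun K (- y k \<omega>)"
    by (rule inner_le_support_fun[OF x_in[OF assms]])
  moreover have "inner (x k \<omega>) (y k \<omega>) - f (x k \<omega>) \<le> real_of_ereal (conjugate f (y k \<omega>))"
    using conjugate_ge[of "x k \<omega>" "y k \<omega>" f] gap_eq(3)[OF assms, of k] by (metis ereal_less_eq(3))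
  ultimately show ?thesis by (simp add: gap_eq(2)[OF assms])
qed

text \<open>
  The unsmoothed support function lies below \<open>G\<close>, and the surplus \<open>\<beta> f x\<^sub>k\<close> of the potential is at least
  \<open>\<beta> fmin\<close> by feasibility.
\<close>

lemma gap_bound:
  assumes "\<omega> \<in> space P"
    and below: "\<And>u. support_fun K u \<le> smoothed_support K \<eta> \<alpha> u"
    and lower: "\<And>u. u \<in> K \<Longrightarrow> fmin \<le> f u"
  shows "A k * gap k \<omega> \<le> \<beta> * (f x0 - fmin) + (\<Sum>i<k. step i * excess i \<omega>)"
proof -
  obtain c where c: "conjugate f (y k \<omega>) \<le> ereal c"
    and le: "A k * (dual_smoothing (y k \<omega>) + c) + (A k + \<beta>) * f (x k \<omega>)
      \<le> \<beta> * f x0 + (\<Sum>i<k. step i * excess i \<omega>)"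
    using potential_bound[OF assms(1)] by blast
  have "real_of_ereal (conjugate f (y k \<omega>)) \<le> c"
    using c gap_eq(3)[OF assms(1), of k] by (metis ereal_less_eq(3))
  then have "gap k \<omega> \<le> f (x k \<omega>) + (dual_smoothing (y k \<omega>) + c)"
    using below[of "- y k \<omega>"] by (simp add: gap_eq(2)[OF assms(1)])
  then have "A k * gap k \<omega> \<le> A k * f (x k \<omega>) + A k * (dual_smoothing (y k \<omega>) + c)"
    using mult_left_mono[OF _ A_nonneg] by (metis distrib_left)
  moreover have "\<beta> * fmin \<le> \<beta> * f (x k \<omega>)"
    using lower[OF x_in[OF assms(1)]] beta_pos by (intro mult_left_mono) auto
  ultimately show ?thesis using le by (simp only: distrib_right right_diff_distrib)
qed

section \<open>Expectations\<close>

lemma Delta_measurable: "i < m \<Longrightarrow> \<Delta> k i \<in> borel_measurable P"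
  using distributed_measurable[OF Delta_law] by simp

lemma Delta_distr: "i < m \<Longrightarrow> distr P borel (\<Delta> k i) = noise_law \<eta>"
  using distributed_distr_eq_density[OF Delta_law]
  by (simp add: noise_law_def cong: distr_cong)

lemma subalgebra_past: "subalgebra P (past_algebra P \<Delta> m k)"
proof -
  have "(\<lambda>\<omega>. restrict (\<lambda>p. (case p of (j, i) \<Rightarrow> \<Delta> j i) \<omega>) ({..<k} \<times> {..<m}))
      \<in> measurable P (PiM ({..<k} \<times> {..<m}) (\<lambda>_. borel))"
    by (intro measurable_restrict) (auto intro: Delta_measurable)
  then show ?thesis
    unfolding subalgebra_def past_algebra_alt
    by (auto simp: sets_vimage_algebra intro!: sets.sigma_sets_subset measurable_sets)
qed

lemma grad_f_measurable: "grad f \<in> borel_measurable borel"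
  by (intro borel_measurable_continuous_onI continuous_grad[OF norm f(3,2)])

lemma mean_argmax_measurable: "mean_argmax \<in> borel_measurable borel"
  by (intro borel_measurable_continuous_onI mean_argmax_continuous)

text \<open>
  The index \<open>k\<close> of the algebra is fixed during the induction, which avoids comparing the algebras of
  different iterations.
\<close>

lemma iterates_past_measurable:
  assumes "j \<le> k"
  shows "x j \<in> borel_measurable (past_algebra P \<Delta> m k) \<and> y j \<in> borel_measurable (past_algebra P \<Delta> m k)
    \<and> d j \<in> borel_measurable (past_algebra P \<Delta> m k)"
  using assms
proof (induction j)
  case 0
  let ?F = "past_algebra P \<Delta> m k"
  have "x 0 \<in> borel_measurable ?F \<longleftrightarrow> (\<lambda>_. x0) \<in> borel_measurable ?F"
    "y 0 \<in> borel_measurable ?F \<longleftrightarrow> (\<lambda>_. grad f x0) \<in> borel_measurable ?F"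
    "d 0 \<in> borel_measurable ?F \<longleftrightarrow> (\<lambda>_. 0 :: 'v) \<in> borel_measurable ?F"
    by (rule measurable_cong, simp add: run_0)+
  then show ?case by simp
next
  case (Suc j)
  let ?F = "past_algebra P \<Delta> m k" and ?t = "tau_seq \<beta> \<mu> j"
  note grad_f_measurable [measurable]
  have [measurable]: "x j \<in> borel_measurable ?F" "y j \<in> borel_measurable ?F" "d j \<in> borel_measurable ?F"
    using Suc by auto
  have "v j \<in> borel_measurable ?F \<longleftrightarrow> (\<lambda>\<omega>. (1 - ?t) *\<^sub>R y j \<omega> + ?t *\<^sub>R grad f (x j \<omega>)) \<in> borel_measurable ?F"
    by (rule measurable_cong) (simp add: run_Suc)
  then have [measurable]: "v j \<in> borel_measurable ?F" by simp
  have [measurable]: "g j i \<in> borel_measurable ?F" if "i < m" for i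
  proof -
    have [measurable]: "\<Delta> j i \<in> borel_measurable ?F"
      using Suc(2) that by (intro past_algebra_measurable) auto
    have "g j i \<in> borel_measurable ?F \<longleftrightarrow> (\<lambda>\<omega>. - lmo (- v j \<omega> + \<alpha> *\<^sub>R \<Delta> j i \<omega>)) \<in> borel_measurable ?F"
      using that by (intro measurable_cong) (simp add: run_Suc)
    then show ?thesis by simp
  qed
  have [measurable]: "g_mean j \<in> borel_measurable ?F"
    unfolding g_mean_def[abs_def] by measurable
  have "d (Suc j) \<in> borel_measurable ?F \<longleftrightarrow> (\<lambda>\<omega>. d j \<omega> + step j *\<^sub>R g_mean j \<omega>) \<in> borel_measurable ?F"
    by (rule measurable_cong) (simp add: run_Suc)
  then have [measurable]: "d (Suc j) \<in> borel_measurable ?F" by simp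
  have "x (Suc j) \<in> borel_measurable ?F \<longleftrightarrow>
      (\<lambda>\<omega>. (\<beta> / (A (Suc j) + \<beta>)) *\<^sub>R x0 - (1 / (A (Suc j) + \<beta>)) *\<^sub>R d (Suc j) \<omega>) \<in> borel_measurable ?F"
    by (rule measurable_cong) (simp add: run_Suc(4))
  then have [measurable]: "x (Suc j) \<in> borel_measurable ?F" by simp
  have "y (Suc j) \<in> borel_measurable ?F \<longleftrightarrow>
      (\<lambda>\<omega>. (1 - ?t) *\<^sub>R y j \<omega> + ?t *\<^sub>R grad f (x (Suc j) \<omega>)) \<in> borel_measurable ?F"
    by (rule measurable_cong) (simp add: run_Suc(5))
  then have "y (Suc j) \<in> borel_measurable ?F" by simp
  then show ?case by simp
qed

lemma v_past_measurable: "v k \<in> borel_measurable (past_algebra P \<Delta> m k)"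
proof -
  let ?F = "past_algebra P \<Delta> m k" and ?t = "tau_seq \<beta> \<mu> k"
  have [measurable]: "x k \<in> borel_measurable ?F" "y k \<in> borel_measurable ?F"
    using iterates_past_measurable[of k k] by auto
  note grad_f_measurable [measurable]
  have "v k \<in> borel_measurable ?F \<longleftrightarrow> (\<lambda>\<omega>. (1 - ?t) *\<^sub>R y k \<omega> + ?t *\<^sub>R grad f (x k \<omega>)) \<in> borel_measurable ?F"
    by (rule measurable_cong) (simp add: run_Suc)
  then show ?thesis by simp
qed

lemma x_measurable [measurable]: "x k \<in> borel_measurable P"
  and y_measurable [measurable]: "y k \<in> borel_measurable P"
  and v_measurable [measurable]: "v k \<in> borel_measurable P"
  using iterates_past_measurable[of k k] v_past_measurable measurable_from_subalg[OF subalgebra_past] by auto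

lemma g_measurable:
  assumes "i < m" shows "g k i \<in> borel_measurable P"
proof -
  note Delta_measurable[OF assms, measurable]
  have "g k i \<in> borel_measurable P \<longleftrightarrow> (\<lambda>\<omega>. - lmo (- v k \<omega> + \<alpha> *\<^sub>R \<Delta> k i \<omega>)) \<in> borel_measurable P"
    using assms by (intro measurable_cong) (simp add: run_Suc)
  then show ?thesis by simp
qed

lemma noise_error_measurable [measurable]: "noise_error k \<in> borel_measurable P"
proof -
  note mean_argmax_measurable [measurable] g_measurable [measurable]
  have [measurable]: "g_mean k \<in> borel_measurable P"
    unfolding g_mean_def[abs_def] by measurable
  show ?thesis unfolding noise_error_def[abs_def] grad_dual_smoothing by measurable
qed

lemma noise_error_bound:
  assumes "\<omega> \<in> space P" shows "dual_norm N (noise_error k \<omega>) \<le> 2 * R"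
proof -
  note D = is_norm_dual_norm[OF norm]
  have "dual_norm N (noise_error k \<omega>) = dual_norm N (g_mean k \<omega> + mean_argmax (- v k \<omega>))"
    by (simp add: noise_error_def grad_dual_smoothing)
  also have "\<dots> \<le> dual_norm N (g_mean k \<omega>) + dual_norm N (mean_argmax (- v k \<omega>))"
    by (rule is_normD(2)[OF D])
  also have "dual_norm N (g_mean k \<omega>) \<le> R"
    using dual_norm_le_R[OF minus_g_mean_in[OF assms]] by (simp add: is_norm_minus[OF D])
  also have "dual_norm N (mean_argmax (- v k \<omega>)) \<le> R"
    using abs_inner_mean_argmax_le abs_le_D1 by (intro dual_norm_leI norm R_nonneg) blast
  finally show ?thesis by simp
qed

lemma grad_f_bounded:
  obtains B where "0 < B" "\<And>u. u \<in> K \<Longrightarrow> norm (grad f u) \<le> B"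
proof -
  have "bounded (grad f ` K)"
    by (intro compact_imp_bounded compact_continuous_image continuous_grad[OF norm f(3,2)] compact)
  then show ?thesis using that unfolding bounded_pos by auto
qed

text \<open>
  The pair \<open>(v\<^sub>k, \<nabla>f x\<^sub>k)\<close> depends on the perturbations of earlier iterations only.
\<close>

lemma past_Delta_joint_distr:
  assumes "i < m"
  shows "distr P (borel \<Otimes>\<^sub>M borel) (\<lambda>\<omega>. (v k \<omega>, grad f (x k \<omega>))) \<Otimes>\<^sub>M noise_law \<eta>
    = distr P ((borel \<Otimes>\<^sub>M borel) \<Otimes>\<^sub>M borel) (\<lambda>\<omega>. ((v k \<omega>, grad f (x k \<omega>)), \<Delta> k i \<omega>))"
proof -
  let ?I = "{..<k} \<times> {..<m}"
  let ?X = "\<lambda>J \<omega>. restrict (\<lambda>p. (case p of (j, i) \<Rightarrow> \<Delta> j i) \<omega>) J"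
  have ind: "P.indep_var (PiM ?I (\<lambda>_. borel)) (?X ?I) (PiM {(k, i)} (\<lambda>_. borel)) (?X {(k, i)})"
    using assms by (intro P.indep_var_restrict[OF Delta_indep]) auto
  have "x k \<in> borel_measurable (past_algebra P \<Delta> m k)"
    using iterates_past_measurable[of k k] by simp
  from measurable_compose[OF this grad_f_measurable]
  have Z: "(\<lambda>\<omega>. (v k \<omega>, grad f (x k \<omega>))) \<in>
      measurable (vimage_algebra (space P) (?X ?I) (PiM ?I (\<lambda>_. borel))) (borel \<Otimes>\<^sub>M borel)"
    unfolding past_algebra_alt[symmetric] using v_past_measurable by (intro measurable_Pair)
  have W: "(\<lambda>h. h (k, i)) \<in> measurable (PiM {(k, i)} (\<lambda>_. borel)) borel"
    by (rule measurable_component_singleton) simp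
  from P.indep_var_joint_distr[OF ind Z W] show ?thesis
    by (simp add: Delta_distr[OF assms])
qed

text \<open>
  By Fubini's theorem the perturbation of step \<open>k\<close> may be integrated out first, for fixed values of
  \<open>v\<^sub>k\<close> and \<open>\<nabla>f x\<^sub>k\<close>, and this inner mean vanishes by the definition of \<open>mean_argmax\<close>.
\<close>

lemma sample_unbiased:
  assumes "i < m"
  shows "integrable P (\<lambda>\<omega>. inner (g k i \<omega> + mean_argmax (- v k \<omega>)) (grad f (x k \<omega>)))"
    and "(\<integral>\<omega>. inner (g k i \<omega> + mean_argmax (- v k \<omega>)) (grad f (x k \<omega>)) \<partial>P) = 0"
proof -
  note grad_f_measurable [measurable] mean_argmax_measurable [measurable]
    Delta_measurable[OF assms, measurable]
  let ?Z = "\<lambda>\<omega>. (v k \<omega>, grad f (x k \<omega>))"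
  \<comment> \<open>The error of one sample as a function of the past, i.e. of \<open>(v\<^sub>k, \<nabla>f x\<^sub>k)\<close>, and of its perturbation.\<close>
  define F where "F p = inner (mean_argmax (- fst (fst p)) - lmo (- fst (fst p) + \<alpha> *\<^sub>R snd p)) (snd (fst p))"
    for p :: "('v \<times> 'v) \<times> 'v"
  have F_meas [measurable]: "F \<in> borel_measurable ((borel \<Otimes>\<^sub>M borel) \<Otimes>\<^sub>M borel)"
    unfolding F_def[abs_def] by measurable
  have eq: "inner (g k i \<omega> + mean_argmax (- v k \<omega>)) (grad f (x k \<omega>)) = F (?Z \<omega>, \<Delta> k i \<omega>)"
    if "\<omega> \<in> space P" for \<omega>
    using run_Suc(2)[OF that assms] by (simp add: F_def)
  obtain C where C: "0 < C" "\<And>u. N u \<le> C * norm u" using is_norm_le_norm[OF norm] by blast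
  obtain B where B: "0 < B" "\<And>u. u \<in> K \<Longrightarrow> norm (grad f u) \<le> B" using grad_f_bounded by blast
  obtain B' where B': "0 < B'" "\<And>u. u \<in> K \<Longrightarrow> norm u \<le> B'" using K_bounded by blast
  have int: "integrable P (\<lambda>\<omega>. F (?Z \<omega>, \<Delta> k i \<omega>))"
  proof (rule P.integrable_const_bound[where B = "R * (C * B) + B' * B"])
    show "AE \<omega> in P. norm (F (?Z \<omega>, \<Delta> k i \<omega>)) \<le> R * (C * B) + B' * B"
    proof (rule AE_I2)
      fix \<omega> assume \<omega>: "\<omega> \<in> space P"
      let ?w = "grad f (x k \<omega>)" and ?l = "lmo (- v k \<omega> + \<alpha> *\<^sub>R \<Delta> k i \<omega>)"
      have w: "norm ?w \<le> B" by (rule B(2)[OF x_in[OF \<omega>]])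
      have "\<bar>inner (mean_argmax (- v k \<omega>)) ?w\<bar> \<le> R * N ?w" by (rule abs_inner_mean_argmax_le)
      also have "N ?w \<le> C * B" using C(2)[of ?w] mult_left_mono[OF w less_imp_le[OF C(1)]] by simp
      finally have 1: "\<bar>inner (mean_argmax (- v k \<omega>)) ?w\<bar> \<le> R * (C * B)"
        using R_nonneg by (simp add: mult_left_mono)
      have "\<bar>inner ?l ?w\<bar> \<le> norm ?l * norm ?w" by (rule Cauchy_Schwarz_ineq2)
      also have "\<dots> \<le> B' * B" using B' w lmo_in by (intro mult_mono) auto
      finally have "\<bar>inner ?l ?w\<bar> \<le> B' * B" .
      with 1 show "norm (F (?Z \<omega>, \<Delta> k i \<omega>)) \<le> R * (C * B) + B' * B"
        by (simp add: F_def inner_diff_left)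
    qed
  qed measurable
  have iff: "integrable P (\<lambda>\<omega>. inner (g k i \<omega> + mean_argmax (- v k \<omega>)) (grad f (x k \<omega>)))
      \<longleftrightarrow> integrable P (\<lambda>\<omega>. F (?Z \<omega>, \<Delta> k i \<omega>))"
    by (rule Bochner_Integration.integrable_cong[OF refl]) (rule eq)
  show "integrable P (\<lambda>\<omega>. inner (g k i \<omega> + mean_argmax (- v k \<omega>)) (grad f (x k \<omega>)))"
    unfolding iff by (rule int)
  let ?D = "distr P (borel \<Otimes>\<^sub>M borel) ?Z"
  have joint: "distr P ((borel \<Otimes>\<^sub>M borel) \<Otimes>\<^sub>M borel) (\<lambda>\<omega>. (?Z \<omega>, \<Delta> k i \<omega>)) = ?D \<Otimes>\<^sub>M noise_law \<eta>"
    by (rule past_Delta_joint_distr[OF assms, symmetric])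
  interpret D: prob_space ?D by (rule P.prob_space_distr) measurable
  interpret DN: pair_sigma_finite ?D "noise_law \<eta>" ..
  have Z_meas: "(\<lambda>\<omega>. (?Z \<omega>, \<Delta> k i \<omega>)) \<in> measurable P ((borel \<Otimes>\<^sub>M borel) \<Otimes>\<^sub>M borel)"
    by measurable
  have "(\<integral>\<omega>. inner (g k i \<omega> + mean_argmax (- v k \<omega>)) (grad f (x k \<omega>)) \<partial>P) = (\<integral>\<omega>. F (?Z \<omega>, \<Delta> k i \<omega>) \<partial>P)"
    using eq by (intro Bochner_Integration.integral_cong) auto
  also have "\<dots> = (\<integral>p. F p \<partial>(?D \<Otimes>\<^sub>M noise_law \<eta>))"
    unfolding joint[symmetric] by (rule integral_distr[OF Z_meas F_meas, symmetric])
  also have "\<dots> = (\<integral>z. (\<integral>u. F (z, u) \<partial>noise_law \<eta>) \<partial>?D)"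
  proof (rule DN.integral_fst'[symmetric])
    show "integrable (?D \<Otimes>\<^sub>M noise_law \<eta>) F"
      unfolding joint[symmetric] using int by (simp add: integrable_distr_eq[OF Z_meas F_meas])
  qed
  also have "\<dots> = (\<integral>z. 0 \<partial>?D)"
  proof (rule Bochner_Integration.integral_cong[OF refl])
    fix z :: "'v \<times> 'v"
    show "(\<integral>u. F (z, u) \<partial>noise_law \<eta>) = 0"
      using lmo_integrable[of "- fst z"] inner_mean_argmax[of "- fst z" "snd z"]
      by (simp add: F_def inner_diff_left noise.prob_space)
  qed
  finally show "(\<integral>\<omega>. inner (g k i \<omega> + mean_argmax (- v k \<omega>)) (grad f (x k \<omega>)) \<partial>P) = 0" by simp
qed

lemma noise_error_unbiased:
  "integrable P (\<lambda>\<omega>. inner (noise_error k \<omega>) (grad f (x k \<omega>)))"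
  "(\<integral>\<omega>. inner (noise_error k \<omega>) (grad f (x k \<omega>)) \<partial>P) = 0"
proof -
  have eq: "noise_error k \<omega> = (\<Sum>i<m. (1 / real m) *\<^sub>R (g k i \<omega> + mean_argmax (- v k \<omega>)))" for \<omega>
    using m by (simp add: noise_error_def g_mean_def grad_dual_smoothing scaleR_add_right
        sum.distrib scaleR_sum_right sum_constant_scaleR)
  show "integrable P (\<lambda>\<omega>. inner (noise_error k \<omega>) (grad f (x k \<omega>)))"
    unfolding eq inner_sum_left inner_scaleR_left
    by (intro Bochner_Integration.integrable_sum integrable_mult_right sample_unbiased) simp
  have "(\<integral>\<omega>. inner (noise_error k \<omega>) (grad f (x k \<omega>)) \<partial>P)
      = (\<Sum>i<m. \<integral>\<omega>. (1 / real m) * inner (g k i \<omega> + mean_argmax (- v k \<omega>)) (grad f (x k \<omega>)) \<partial>P)"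
    unfolding eq inner_sum_left inner_scaleR_left
    by (intro Bochner_Integration.integral_sum integrable_mult_right sample_unbiased) simp
  also have "\<dots> = 0"
    by (intro sum.neutral ballI) (simp add: sample_unbiased)
  finally show "(\<integral>\<omega>. inner (noise_error k \<omega>) (grad f (x k \<omega>)) \<partial>P) = 0" .
qed

text \<open>
  Boundedness of the error makes its square integrable, so that integrating the conditional
  expectation returns the plain one.
\<close>

lemma noise_error_second_moment:
  assumes "AE \<omega> in P. real_cond_exp P (past_algebra P \<Delta> m k)
      (\<lambda>\<omega>. (dual_norm N (noise_error k \<omega>))\<^sup>2) \<omega> \<le> V"
  shows "integrable P (\<lambda>\<omega>. (dual_norm N (noise_error k \<omega>))\<^sup>2)"
    "(\<integral>\<omega>. (dual_norm N (noise_error k \<omega>))\<^sup>2 \<partial>P) \<le> V"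
proof -
  note is_norm_measurable[OF is_norm_dual_norm[OF norm], measurable]
  let ?V = "\<lambda>\<omega>. (dual_norm N (noise_error k \<omega>))\<^sup>2"
  show int: "integrable P ?V"
  proof (rule P.integrable_const_bound[where B = "(2 * R)\<^sup>2"])
    show "AE \<omega> in P. norm (?V \<omega>) \<le> (2 * R)\<^sup>2"
    proof (rule AE_I2)
      fix \<omega> assume "\<omega> \<in> space P"
      from power_mono[OF noise_error_bound[OF this] dual_norm_nonneg[OF norm], of k 2]
      show "norm (?V \<omega>) \<le> (2 * R)\<^sup>2" by simp
    qed
  qed measurable
  interpret F: finite_measure_subalgebra P "past_algebra P \<Delta> m k"
    by unfold_locales (rule subalgebra_past)
  have "(\<integral>\<omega>. ?V \<omega> \<partial>P) = (\<integral>\<omega>. real_cond_exp P (past_algebra P \<Delta> m k) ?V \<omega> \<partial>P)"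
    using F.real_cond_exp_int(2)[OF int] by simp
  also have "\<dots> \<le> (\<integral>\<omega>. V \<partial>P)"
    using F.real_cond_exp_int(1)[OF int] assms by (intro integral_mono_AE) auto
  finally show "(\<integral>\<omega>. ?V \<omega> \<partial>P) \<le> V" by (simp add: P.prob_space)
qed

lemma gap_measurable: "gap k \<in> borel_measurable P"
proof -
  have [measurable]: "f \<in> borel_measurable borel"
    by (intro borel_measurable_continuous_onI GDERIV_continuous[OF smooth_dual_GDERIV[OF f(3)]])
  have "gap k \<in> borel_measurable P \<longleftrightarrow> (\<lambda>\<omega>. f (x k \<omega>) + support_fun K (- y k \<omega>)
      + real_of_ereal (conjugate f (y k \<omega>))) \<in> borel_measurable P"
    by (rule measurable_cong) (rule gap_eq(2))
  then show ?thesis by simp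
qed

text \<open>
  The pathwise bound is integrated term by term.  It also yields integrability of the gap, which lies
  between zero and an integrable variable.
\<close>

lemma expected_gap:
  assumes below: "\<And>u. support_fun K u \<le> smoothed_support K \<eta> \<alpha> u"
    and lower: "\<And>u. u \<in> K \<Longrightarrow> fmin \<le> f u"
    and variance: "\<And>k. AE \<omega> in P. real_cond_exp P (past_algebra P \<Delta> m k)
      (\<lambda>\<omega>. (dual_norm N (noise_error k \<omega>))\<^sup>2) \<omega> \<le> V"
    and k: "0 < A k"
  shows "integrable P (gap k)"
    "(\<integral>\<omega>. gap k \<omega> \<partial>P) \<le> \<beta> / A k * (f x0 - fmin) + V / (2 * s) + \<alpha> * smoothed_support K \<eta> 1 0"
proof -
  let ?c = "\<alpha> * smoothed_support K \<eta> 1 0"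
  have ex_int: "integrable P (excess i)" for i
    unfolding excess_def[abs_def]
    using noise_error_unbiased(1) noise_error_second_moment(1)[OF variance] by auto
  have ex_le: "(\<integral>\<omega>. excess i \<omega> \<partial>P) \<le> ?c + V / (2 * s)" for i
  proof -
    have "(\<integral>\<omega>. excess i \<omega> \<partial>P) = ?c + (\<integral>\<omega>. (dual_norm N (noise_error i \<omega>))\<^sup>2 \<partial>P) / (2 * s)"
      unfolding excess_def
      using noise_error_unbiased[of i] noise_error_second_moment(1)[OF variance[of i]]
      by (simp add: P.prob_space)
    also have "\<dots> \<le> ?c + V / (2 * s)"
      using noise_error_second_moment(2)[OF variance] s_pos by (intro add_left_mono divide_right_mono) auto
    finally show ?thesis .
  qed
  define Z where "Z \<omega> = \<beta> * (f x0 - fmin) + (\<Sum>i<k. step i * excess i \<omega>)" for \<omega>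
  have Z_int: "integrable P Z" unfolding Z_def[abs_def] using ex_int by auto
  have Z: "gap k \<omega> \<le> Z \<omega> / A k" if "\<omega> \<in> space P" for \<omega>
    using gap_bound[OF that below lower, of k] k by (simp add: Z_def field_simps)
  show gap_int: "integrable P (gap k)"
  proof (rule Bochner_Integration.integrable_bound)
    show "integrable P (\<lambda>\<omega>. Z \<omega> / A k)" using Z_int by simp
    show "AE \<omega> in P. norm (gap k \<omega>) \<le> norm (Z \<omega> / A k)"
    proof (rule AE_I2)
      fix \<omega> assume "\<omega> \<in> space P"
      from gap_nonneg[OF this, of k] Z[OF this] abs_ge_self[of "Z \<omega> / A k"]
      show "norm (gap k \<omega>) \<le> norm (Z \<omega> / A k)" unfolding real_norm_def by linarith
    qed
  qed (rule gap_measurable)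
  have "(\<integral>\<omega>. gap k \<omega> \<partial>P) \<le> (\<integral>\<omega>. Z \<omega> / A k \<partial>P)"
    using gap_int Z_int Z by (intro integral_mono) auto
  also have "\<dots> = (\<beta> * (f x0 - fmin) + (\<Sum>i<k. step i * (\<integral>\<omega>. excess i \<omega> \<partial>P))) / A k"
    unfolding Z_def using ex_int by (simp add: Bochner_Integration.integral_sum P.prob_space)
  also have "\<dots> \<le> (\<beta> * (f x0 - fmin) + (\<Sum>i<k. step i * (?c + V / (2 * s)))) / A k"
    using k by (intro divide_right_mono add_left_mono sum_mono mult_left_mono ex_le less_imp_le[OF step_pos]) auto
  also have "(\<Sum>i<k. step i * (?c + V / (2 * s))) = A k * (?c + V / (2 * s))"
    by (simp only: sum_distrib_right[symmetric] sum_step)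
  also have "(\<beta> * (f x0 - fmin) + A k * (?c + V / (2 * s))) / A k
      = \<beta> / A k * (f x0 - fmin) + V / (2 * s) + ?c"
    using k by (simp add: add_divide_distrib)
  finally show "(\<integral>\<omega>. gap k \<omega> \<partial>P) \<le> \<beta> / A k * (f x0 - fmin) + V / (2 * s) + ?c" .
qed

end

section \<open>Convergence in expectation\<close>

theorem theorem2:
  fixes N :: "'v::euclidean_space \<Rightarrow> real"
    and K :: "'v set" and f :: "'v \<Rightarrow> real" and \<eta> :: "'v \<Rightarrow> real"
    and L \<alpha> R M \<rho> :: real and m :: nat
    and lmo :: "'v \<Rightarrow> 'v" and x0 xs :: 'v
    and P :: "'b measure" and \<Delta> :: "nat \<Rightarrow> nat \<Rightarrow> 'b \<Rightarrow> 'v"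
    and x y d v :: "nat \<Rightarrow> 'b \<Rightarrow> 'v" and g :: "nat \<Rightarrow> nat \<Rightarrow> 'b \<Rightarrow> 'v"
  assumes norm: "is_norm N"
    and K: "K \<noteq> {}" "convex K" "compact K"
    and f: "convex_on UNIV f" "L > 0" "smooth_dual N L f"
    and x0: "x0 \<in> K"
    and xs: "is_arg_min f (\<lambda>u. u \<in> K) xs"
    and R: "R = (SUP u\<in>K. dual_norm N u)" "R > 0"
    and density: "\<And>z. \<eta> differentiable (at z)" "integrable lborel (\<lambda>z. exp (- \<eta> z))"
    and M: "integrable (noise_law \<eta>) (\<lambda>z. (dual_norm N (grad \<eta> z))\<^sup>2)"
      "M = sqrt (\<integral>z. (dual_norm N (grad \<eta> z))\<^sup>2 \<partial>noise_law \<eta>)" "M > 0"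
    and s1_finite: "integrable (noise_law \<eta>) (support_fun K)"
    and s_le_smoothed: "\<And>w. support_fun K w \<le> smoothed_support K \<eta> \<alpha> w"
    and parameters: "\<alpha> > 0" "m \<ge> 1" "R * M / \<alpha> \<ge> 1 / L"
    and lmo: "lin_max_selection K lmo"
    and P: "prob_space P"
    and Delta_law: "\<And>k i. i < m \<Longrightarrow> distributed P lborel (\<Delta> k i) (\<lambda>z. ennreal (noise_density \<eta> z))"
    and Delta_indep: "prob_space.indep_vars P (\<lambda>_. borel) (\<lambda>(k, i). \<Delta> k i) (UNIV \<times> {..<m})"
    and algorithm: "\<And>\<omega>. \<omega> \<in> space P \<Longrightarrow>
      parallel_frank_wolfe f lmo \<alpha> (R * M / \<alpha>) (1 / L) m x0 (\<lambda>k i. \<Delta> k i \<omega>)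
        (\<lambda>k. x k \<omega>) (\<lambda>k. y k \<omega>) (\<lambda>k. d k \<omega>) (\<lambda>k. v k \<omega>) (\<lambda>k i. g k i \<omega>)"
    and variance: "\<And>k. AE \<omega> in P.
      real_cond_exp P (past_algebra P \<Delta> m k)
        (\<lambda>\<omega>. (dual_norm N ((1 / real m) *\<^sub>R (\<Sum>i<m. g k i \<omega>)
                - grad (\<lambda>w. smoothed_support K \<eta> \<alpha> (- w)) (v k \<omega>)))\<^sup>2) \<omega>
      \<le> 4 * R\<^sup>2 * \<rho> / real m"
  shows "(\<forall>k. \<forall>\<omega>\<in>space P. x k \<omega> \<in> K) \<and>
    (\<forall>k\<ge>1.
      (\<forall>\<omega>\<in>space P. \<bar>dual_objective K f (y k \<omega>)\<bar> \<noteq> \<infinity>) \<and>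
      integrable P (\<lambda>\<omega>. f (x k \<omega>) - real_of_ereal (dual_objective K f (y k \<omega>))) \<and>
      (\<integral>\<omega>. f (x k \<omega>) - real_of_ereal (dual_objective K f (y k \<omega>)) \<partial>P)
        \<le> exp (- (real k - 1) * (sqrt \<alpha> / (8 * sqrt (L * R * M))))
              * (2 * L * (R * M / \<alpha>)) * (f x0 - f xs)
          + 2 * R\<^sup>2 * \<rho> / real m * sqrt (\<alpha> * L / (R * M))
          + \<alpha> * smoothed_support K \<eta> 1 0)"
proof -
  have noise: "prob_space (noise_law \<eta>)"
  proof -
    have "0 < m" using parameters by simp
    from Delta_law[OF this, of 0] have D: "distributed P lborel (\<Delta> 0 0) (\<lambda>z. ennreal (noise_density \<eta> z))" .
    have "prob_space (distr P lborel (\<Delta> 0 0))"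
      using distributed_measurable[OF D] by (rule prob_space.prob_space_distr[OF P])
    then show ?thesis using distributed_distr_eq_density[OF D] by (simp add: noise_law_def)
  qed
  interpret smoothing: perturbed_argmax N K \<eta> \<alpha> R M lmo
    using norm K(3) R(1) density(1) noise M(1,2) s1_finite parameters(1) lmo
    by (intro perturbed_argmax.intro)
  interpret run: frank_wolfe_run N K \<eta> \<alpha> R M lmo P f L m x0 \<Delta> x y d v g
    using P K(2) f x0 R(2) M(3) parameters(2) Delta_law Delta_indep algorithm
    by (intro frank_wolfe_run.intro frank_wolfe_run_axioms.intro smoothing.perturbed_argmax_axioms)
  let ?\<beta> = "R * M / \<alpha>" and ?\<mu> = "1 / L"
  let ?V = "4 * R\<^sup>2 * \<rho> / real m"
  have lower: "f xs \<le> f u" if "u \<in> K" for u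
    using xs that unfolding is_arg_min_def by (meson not_less)
  have var: "AE \<omega> in P. real_cond_exp P (past_algebra P \<Delta> m k)
      (\<lambda>\<omega>. (dual_norm N (run.noise_error k \<omega>))\<^sup>2) \<omega> \<le> ?V" for k
    using variance[of k] unfolding run.noise_error_def run.g_mean_def .
  have pos: "0 < ?\<mu>" "0 < ?\<beta>" "?\<mu> \<le> ?\<beta>" using run.mu_pos run.beta_pos parameters(3)
    unfolding run.\<beta>_def run.\<mu>_def by auto
  have rate: "sqrt (?\<mu> / ?\<beta>) / 8 = sqrt \<alpha> / (8 * sqrt (L * R * M))"
    using f(2) R(2) M(3) parameters(1) by (simp add: real_sqrt_divide real_sqrt_mult field_simps)
  have noise_term: "?V / (2 * sqrt (?\<mu> * ?\<beta>)) = 2 * R\<^sup>2 * \<rho> / real m * sqrt (\<alpha> * L / (R * M))"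
    using f(2) R(2) M(3) parameters(1,2) by (simp add: real_sqrt_divide real_sqrt_mult field_simps)
  have bound: "\<bar>dual_objective K f (y k \<omega>)\<bar> \<noteq> \<infinity>" if "\<omega> \<in> space P" for k \<omega>
    by (rule run.gap_eq(1)[OF that])
  have main: "integrable P (run.gap k) \<and> (\<integral>\<omega>. run.gap k \<omega> \<partial>P)
        \<le> exp (- (real k - 1) * (sqrt \<alpha> / (8 * sqrt (L * R * M))))
              * (2 * L * (R * M / \<alpha>)) * (f x0 - f xs)
          + 2 * R\<^sup>2 * \<rho> / real m * sqrt (\<alpha> * L / (R * M))
          + \<alpha> * smoothed_support K \<eta> 1 0" if k: "k \<ge> 1" for k
  proof -
    let ?q = "sqrt \<alpha> / (8 * sqrt (L * R * M))" and ?A = "A_seq ?\<beta> ?\<mu> k"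
    \<comment> \<open>The growth estimate starts at \<open>A\<^sub>1\<close>, whence the exponent \<open>k - 1\<close>.\<close>
    obtain j where j: "k = Suc j" using k by (cases k) auto
    have "?\<mu> / 2 * exp (real j * ?q) \<le> ?A"
      using A_seq_growth[OF pos(1,3), of j] unfolding rate j .
    then have growth: "?\<mu> / 2 * exp ((real k - 1) * ?q) \<le> ?A" by (simp add: j)
    have A_pos: "0 < ?A" using growth f(2) by (simp add: order_less_le_trans[rotated])
    have "?\<beta> / ?A \<le> ?\<beta> / (?\<mu> / 2 * exp ((real k - 1) * ?q))"
      using growth pos A_pos by (intro divide_left_mono) auto
    also have "\<dots> = exp (- (real k - 1) * ?q) * (2 * L * ?\<beta>)"
      using f(2) unfolding minus_mult_minus exp_minus mult_minus_left by (simp add: field_simps)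
    finally have "?\<beta> / ?A * (f x0 - f xs) \<le> exp (- (real k - 1) * ?q) * (2 * L * ?\<beta>) * (f x0 - f xs)"
      using lower[OF x0] by (intro mult_right_mono) auto
    moreover have "integrable P (run.gap k)"
      "(\<integral>\<omega>. run.gap k \<omega> \<partial>P) \<le> ?\<beta> / ?A * (f x0 - f xs) + ?V / (2 * sqrt (?\<mu> * ?\<beta>))
        + \<alpha> * smoothed_support K \<eta> 1 0"
      using run.expected_gap[OF s_le_smoothed lower var, of k] A_pos
      unfolding run.\<beta>_def run.\<mu>_def by blast+
    ultimately show ?thesis unfolding noise_term by linarith
  qed
  note main' = main[unfolded run.gap_def]
  show ?thesis
    by (intro conjI allI ballI impI run.x_in bound main'[THEN conjunct1] main'[THEN conjunct2]) assumption+
qed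

end
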